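(* Let $(I,J,K)$ be a hypercomplex structure on a Courant algebroid $(E,\rho,\langle\cdot,\cdot\rangle,\circ)$ over a smooth manifold $M$. There exists a unique hypercomplex connection $\nabla$ on $E$ that satisfies $$\nabla I=\nabla J=\nabla K=0$$ and, for all $U,V\in\Gamma(E)$, $$T^{\nabla}(U,V)=I\mathcal{D}\langle U,IV\rangle+J\mathcal{D}\langle U,JV\rangle+K\mathcal{D}\langle U,KV\rangle .$$ It is given by $$\nabla_{U}V=-\tfrac{1}{2}K\big(JV\circ IU-J(V\circ IU)-I(JV\circ U)+JI(V\circ U)\big),\qquad U,V\in\Gamma(E).$$
   Context: A Courant algebroid $(E,\rho,\langle\cdot,\cdot\rangle,\circ)$ over a smooth manifold $M$ is a real vector bundle $E\to M$ with a nondegenerate symmetric pairing $\langle\cdot,\cdot\rangle$ on the fibres, a bundle map $\rho:E\to TM$ (anchor) and an $\mathbb{R}$-bilinear operation $\circ$ on $\Gamma(E)$ (Dorfman bracket) such that for all $f\in C^\infty(M)$, $x,y,z\in\Gamma(E)$: $x\circ(y\circ z)=(x\circ y)\circ z+y\circ(x\circ z)$; $\rho(x\circ y)=[\rho(x),\rho(y)]$; $x\circ fy=(\rho(x)f)y+f(x\circ y)$; $x\circ y+y\circ x=2\mathcal{D}\langle x,y\rangle$; $\mathcal{D}f\circ x=0$; $\rho(x)\langle y,z\rangle=\langle x\circ y,z\rangle+\langle y,x\circ z\rangle$; where $\mathcal{D}:C^\infty(M)\to\Gamma(E)$ is defined by $\langle\mathcal{D}f,x\rangle=\frac12\rho(x)f$.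 For endomorphisms $F,G$ of the vector bundle $E$ (over $\mathrm{id}_M$), the Nijenhuis concomitant is $\mathcal{N}(F,G)(U,V)=FU\circ GV-F(U\circ GV)-G(FU\circ V)+FG(U\circ V)+GU\circ FV-G(U\circ FV)-F(GU\circ V)+GF(U\circ V)$, $U,V\in\Gamma(E)$. An almost complex structure on $E$ is a vector bundle endomorphism $J$ of $E$ orthogonal for $\langle\cdot,\cdot\rangle$ with $J^2=-1$. An almost hypercomplex structure on $E$ is a triple $(I,J,K)$ of almost complex structures with $I^2=J^2=K^2=IJK=-1$. It is a hypercomplex structure if $\mathcal{N}(I,I)$, $\mathcal{N}(I,J)$, $\mathcal{N}(I,K)$, $\mathcal{N}(J,J)$, $\mathcal{N}(J,K)$, $\mathcal{N}(K,K)$ all vanish. Given an almost hypercomplex structure, put $\triangle_f(U,V)=\langle U,V\rangle\mathcal{D}f+\langle IU,V\rangle I\mathcal{D}f+\langle JU,V\rangle J\mathcal{D}f+\langle KU,V\rangle K\mathcal{D}f$. A hypercomplex connection is an $\mathbb{R}$-bilinear map $\Gamma(E)\times\Gamma(E)\to\Gamma(E)$, $(U,V)\mapsto\nabla_UV$, with $\nabla_{fU}V=f\nabla_UV$ and $\nabla_U(fV)=(\rho(U)f)V+f\nabla_UV-\triangle_f(U,V)$ for all $f\in C^\infty(M)$, $U,V\in\Gamma(E)$. Its torsion is $T^\nabla(U,V)=\nabla_UV-\nabla_VU-\frac12(U\circ V-V\circ U)$. $\nabla I=0$ means $\nabla_U(IV)=I\nabla_UV$ for all $U,V$, and similarly for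 $J,K$. *)

theory Defs
  imports "HOL-Analysis.Analysis" "HOL-Library.Function_Algebras"
begin

section \<open>Functions as a real vector space\<close>

text \<open>Sections of bundles and derivations are functions; they are added and scaled pointwise.\<close>

instantiation "fun" :: (type, real_vector) real_vector
begin

definition scaleR_fun :: "real \<Rightarrow> ('a \<Rightarrow> 'b) \<Rightarrow> 'a \<Rightarrow> 'b"
  where "scaleR_fun r f = (\<lambda>x. r *\<^sub>R f x)"

instance
  by standard (simp_all add: scaleR_fun_def fun_eq_iff scaleR_add_right scaleR_add_left)

end

section \<open>Smooth manifolds\<close>

text \<open>\<open>C_on k S f\<close>: \<open>f\<close> is of class \<open>C\<^sup>k\<close> on the open set \<open>S\<close>. Since the domain is always
  finite-dimensional below, continuity of the derivative is tested on each vector separately.\<close>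

primrec C_on :: "nat \<Rightarrow> 'a::real_normed_vector set \<Rightarrow> ('a \<Rightarrow> 'b::real_normed_vector) \<Rightarrow> bool" where
  "C_on 0 S f \<longleftrightarrow> continuous_on S f"
| "C_on (Suc k) S f \<longleftrightarrow>
     (\<exists>f'. (\<forall>x\<in>S. (f has_derivative f' x) (at x)) \<and> (\<forall>v. C_on k S (\<lambda>x. f' x v)))"

definition smooth_on :: "'a::real_normed_vector set \<Rightarrow> ('a \<Rightarrow> 'b::real_normed_vector) \<Rightarrow> bool" where
  "smooth_on S f \<longleftrightarrow> (\<forall>k. C_on k S f)"

text \<open>A chart is an open set together with a coordinate map into the model space \<open>'e\<close>, whose
  values outside the open set are irrelevant.\<close>

type_synonym ('m, 'e) atlas = "('m set \<times> ('m \<Rightarrow> 'e)) set"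

text \<open>The manifold is the whole type \<open>'m\<close>. The model space is a finite-dimensional normed space
  rather than a type of class \<open>euclidean_space\<close>, so that dimension 0 is not excluded.\<close>

definition smooth_manifold ::
  "('m::{t2_space,second_countable_topology}, 'e::real_normed_vector) atlas \<Rightarrow> bool" where
  "smooth_manifold A \<longleftrightarrow>
     (\<exists>B::'e set. finite B \<and> span B = UNIV) \<and>
     (\<Union>(W,\<phi>)\<in>A. W) = UNIV \<and>
     (\<forall>(W,\<phi>)\<in>A. open W \<and> inj_on \<phi> W \<and> open (\<phi> ` W) \<and>
        homeomorphism W (\<phi> ` W) \<phi> (inv_into W \<phi>)) \<and>
     (\<forall>(W,\<phi>)\<in>A. \<forall>(W',\<phi>')\<in>A. smooth_on (\<phi> ` (W \<inter> W')) (\<phi>' \<circ> inv_into W \<phi>))"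

definition smooth_fun_on ::
  "('m, 'e::real_normed_vector) atlas \<Rightarrow> 'm set \<Rightarrow> ('m \<Rightarrow> real) \<Rightarrow> bool" where
  "smooth_fun_on A U f \<longleftrightarrow> (\<forall>(W,\<phi>)\<in>A. smooth_on (\<phi> ` (U \<inter> W)) (f \<circ> inv_into W \<phi>))"

definition smooth_funs :: "('m, 'e::real_normed_vector) atlas \<Rightarrow> ('m \<Rightarrow> real) set" where
  "smooth_funs A = {f. smooth_fun_on A UNIV f}"

section \<open>Smooth vector bundles\<close>

text \<open>The fibres are subspaces of an ambient real vector space \<open>'v\<close>. This is no restriction, as
  one can take for \<open>'v\<close> the direct sum of all the fibres: no continuity in the base point is
  required of the way the fibres sit in \<open>'v\<close>. The smooth structure is carried by a bundle atlas
  of local frames \<open>(U, [e\<^sub>1, \<dots>, e\<^sub>r])\<close>, i.e. by local trivialisations \<open>U \<times> \<real>\<^sup>r \<rightarrow> E\<close>.\<close>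

record ('m, 'v) vbundle =
  fibre :: "'m \<Rightarrow> 'v set"
  frames :: "('m set \<times> ('m \<Rightarrow> 'v) list) set"

definition sections_on ::
  "('m, 'e::real_normed_vector) atlas \<Rightarrow> ('m, 'v::real_vector) vbundle \<Rightarrow> 'm set \<Rightarrow> ('m \<Rightarrow> 'v) set" where
  "sections_on A E U = {s. (\<forall>p\<in>U. s p \<in> fibre E p) \<and>
     (\<forall>(W,es)\<in>frames E. \<exists>c. (\<forall>i<length es. smooth_fun_on A (U \<inter> W) (c i)) \<and>
        (\<forall>p\<in>U \<inter> W. s p = (\<Sum>i<length es. c i p *\<^sub>R (es ! i) p)))}"

definition smooth_vector_bundle ::
  "('m::topological_space, 'e::real_normed_vector) atlas \<Rightarrow> ('m, 'v::real_vector) vbundle \<Rightarrow> bool" where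
  "smooth_vector_bundle A E \<longleftrightarrow>
     (\<Union>(U,es)\<in>frames E. U) = UNIV \<and>
     (\<exists>r. \<forall>(U,es)\<in>frames E. length es = r) \<and>
     (\<forall>(U,es)\<in>frames E. open U \<and>
        (\<forall>p\<in>U. distinct (map (\<lambda>e. e p) es) \<and> independent ((\<lambda>e. e p) ` set es) \<and>
               span ((\<lambda>e. e p) ` set es) = fibre E p) \<and>
        (\<forall>e\<in>set es. e \<in> sections_on A E U))"

text \<open>Vector bundle morphisms over the identity; values outside the fibres are irrelevant.\<close>

definition bundle_map ::
  "('m, 'e::real_normed_vector) atlas \<Rightarrow> ('m, 'v::real_vector) vbundle \<Rightarrow>
   ('m, 'w::real_vector) vbundle \<Rightarrow> ('m \<Rightarrow> 'v \<Rightarrow> 'w) \<Rightarrow> bool" where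
  "bundle_map A E E' F \<longleftrightarrow>
     (\<forall>p. (\<forall>x\<in>fibre E p. F p x \<in> fibre E' p) \<and>
          (\<forall>x\<in>fibre E p. \<forall>y\<in>fibre E p. F p (x + y) = F p x + F p y) \<and>
          (\<forall>c. \<forall>x\<in>fibre E p. F p (c *\<^sub>R x) = c *\<^sub>R F p x)) \<and>
     (\<forall>(U,es)\<in>frames E. \<forall>e\<in>set es. (\<lambda>p. F p (e p)) \<in> sections_on A E' U)"

definition app :: "('m \<Rightarrow> 'v \<Rightarrow> 'w) \<Rightarrow> ('m \<Rightarrow> 'v) \<Rightarrow> 'm \<Rightarrow> 'w"  (infixr "\<cdot>" 90) where
  "F \<cdot> s = (\<lambda>p. F p (s p))"

definition fscale :: "('m \<Rightarrow> real) \<Rightarrow> ('m \<Rightarrow> 'v::real_vector) \<Rightarrow> 'm \<Rightarrow> 'v"  (infixr "\<odot>" 75) where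
  "f \<odot> s = (\<lambda>p. f p *\<^sub>R s p)"

section \<open>The tangent bundle\<close>

text \<open>Tangent vectors at \<open>p\<close> are the derivations of \<open>C\<^sup>\<infinity>(M)\<close> at \<open>p\<close>, set to 0 on non-smooth
  functions to make them determined by their values on \<open>C\<^sup>\<infinity>(M)\<close>.\<close>

definition tangent_space ::
  "('m, 'e::real_normed_vector) atlas \<Rightarrow> 'm \<Rightarrow> (('m \<Rightarrow> real) \<Rightarrow> real) set" where
  "tangent_space A p = {v.
     (\<forall>f\<in>smooth_funs A. \<forall>g\<in>smooth_funs A. v (f + g) = v f + v g) \<and>
     (\<forall>c. \<forall>f\<in>smooth_funs A. v (c *\<^sub>R f) = c * v f) \<and>
     (\<forall>f\<in>smooth_funs A. \<forall>g\<in>smooth_funs A. v (f * g) = f p * v g + g p * v f) \<and>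
     (\<forall>f. f \<notin> smooth_funs A \<longrightarrow> v f = 0)}"

definition coord_field ::
  "('m, 'e::real_normed_vector) atlas \<Rightarrow> 'm set \<Rightarrow> ('m \<Rightarrow> 'e) \<Rightarrow> 'e \<Rightarrow> 'm \<Rightarrow> ('m \<Rightarrow> real) \<Rightarrow> real" where
  "coord_field A W \<phi> b = (\<lambda>p f. if f \<in> smooth_funs A
     then frechet_derivative (f \<circ> inv_into W \<phi>) (at (\<phi> p)) b else 0)"

definition tangent_bundle ::
  "('m, 'e::real_normed_vector) atlas \<Rightarrow> ('m, ('m \<Rightarrow> real) \<Rightarrow> real) vbundle" where
  "tangent_bundle A = \<lparr>fibre = tangent_space A,
     frames = {(W, map (coord_field A W \<phi>) bs) | W \<phi> bs.
       (W,\<phi>) \<in> A \<and> distinct bs \<and> independent (set bs) \<and> span (set bs) = UNIV}\<rparr>"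

definition lie_derivative :: "('m \<Rightarrow> ('m \<Rightarrow> real) \<Rightarrow> real) \<Rightarrow> ('m \<Rightarrow> real) \<Rightarrow> 'm \<Rightarrow> real" where
  "lie_derivative X f = (\<lambda>p. X p f)"

definition lie_bracket ::
  "('m, 'e::real_normed_vector) atlas \<Rightarrow> ('m \<Rightarrow> ('m \<Rightarrow> real) \<Rightarrow> real) \<Rightarrow>
   ('m \<Rightarrow> ('m \<Rightarrow> real) \<Rightarrow> real) \<Rightarrow> 'm \<Rightarrow> ('m \<Rightarrow> real) \<Rightarrow> real" where
  "lie_bracket A X Y = (\<lambda>p f. if f \<in> smooth_funs A
     then lie_derivative X (lie_derivative Y f) p - lie_derivative Y (lie_derivative X f) p else 0)"

section \<open>Courant algebroids\<close>

record ('m, 'e, 'v) courant =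
  base :: "('m, 'e) atlas"
  vbdl :: "('m, 'v) vbundle"
  anchor :: "'m \<Rightarrow> 'v \<Rightarrow> ('m \<Rightarrow> real) \<Rightarrow> real"
  pairing :: "'m \<Rightarrow> 'v \<Rightarrow> 'v \<Rightarrow> real"
  dorfman :: "('m \<Rightarrow> 'v) \<Rightarrow> ('m \<Rightarrow> 'v) \<Rightarrow> 'm \<Rightarrow> 'v"

definition smooths :: "('m, 'e::real_normed_vector, 'v) courant \<Rightarrow> ('m \<Rightarrow> real) set" where
  "smooths C = smooth_funs (base C)"

definition sections :: "('m, 'e::real_normed_vector, 'v::real_vector) courant \<Rightarrow> ('m \<Rightarrow> 'v) set" where
  "sections C = sections_on (base C) (vbdl C) UNIV"

definition pair :: "('m, 'e, 'v) courant \<Rightarrow> ('m \<Rightarrow> 'v) \<Rightarrow> ('m \<Rightarrow> 'v) \<Rightarrow> 'm \<Rightarrow> real" where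
  "pair C U V = (\<lambda>p. pairing C p (U p) (V p))"

text \<open>\<open>\<rho>(U)f\<close>\<close>

definition anchor_deriv :: "('m, 'e, 'v) courant \<Rightarrow> ('m \<Rightarrow> 'v) \<Rightarrow> ('m \<Rightarrow> real) \<Rightarrow> 'm \<Rightarrow> real" where
  "anchor_deriv C U f = lie_derivative (anchor C \<cdot> U) f"

definition smooth_metric ::
  "('m, 'e::real_normed_vector) atlas \<Rightarrow> ('m, 'v::real_vector) vbundle \<Rightarrow> ('m \<Rightarrow> 'v \<Rightarrow> 'v \<Rightarrow> real) \<Rightarrow> bool" where
  "smooth_metric A E g \<longleftrightarrow>
     (\<forall>p. (\<forall>x\<in>fibre E p. \<forall>y\<in>fibre E p. \<forall>z\<in>fibre E p. g p (x + y) z = g p x z + g p y z) \<and>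
          (\<forall>c. \<forall>x\<in>fibre E p. \<forall>y\<in>fibre E p. g p (c *\<^sub>R x) y = c * g p x y) \<and>
          (\<forall>x\<in>fibre E p. \<forall>y\<in>fibre E p. g p x y = g p y x) \<and>
          (\<forall>x\<in>fibre E p. (\<forall>y\<in>fibre E p. g p x y = 0) \<longrightarrow> x = 0)) \<and>
     (\<forall>(U,es)\<in>frames E. \<forall>e\<in>set es. \<forall>e'\<in>set es. smooth_fun_on A U (\<lambda>p. g p (e p) (e' p)))"

definition real_bilinear_on :: "('a::real_vector) set \<Rightarrow> ('a \<Rightarrow> 'a \<Rightarrow> 'a) \<Rightarrow> bool" where
  "real_bilinear_on S B \<longleftrightarrow>
     (\<forall>x\<in>S. \<forall>y\<in>S. B x y \<in> S) \<and>
     (\<forall>x\<in>S. \<forall>y\<in>S. \<forall>z\<in>S. B (x + y) z = B x z + B y z \<and> B z (x + y) = B z x + B z y) \<and>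
     (\<forall>c. \<forall>x\<in>S. \<forall>y\<in>S. B (c *\<^sub>R x) y = c *\<^sub>R B x y \<and> B x (c *\<^sub>R y) = c *\<^sub>R B x y)"

text \<open>\<open>\<D>f\<close> is defined fibre by fibre from \<open>\<langle>\<D>f, x\<rangle> = \<rho>(x)f / 2\<close>; by nondegeneracy of the
  pairing such a vector exists and is unique at every point.\<close>

definition grad :: "('m, 'e, 'v) courant \<Rightarrow> ('m \<Rightarrow> real) \<Rightarrow> 'm \<Rightarrow> 'v" where
  "grad C f = (\<lambda>p. THE e. e \<in> fibre (vbdl C) p \<and>
     (\<forall>x\<in>fibre (vbdl C) p. pairing C p e x = anchor C p x f / 2))"

definition courant_algebroid ::
  "('m::{t2_space,second_countable_topology}, 'e::real_normed_vector, 'v::real_vector) courant \<Rightarrow> bool" where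
  "courant_algebroid C \<longleftrightarrow>
     smooth_manifold (base C) \<and>
     smooth_vector_bundle (base C) (vbdl C) \<and>
     smooth_metric (base C) (vbdl C) (pairing C) \<and>
     bundle_map (base C) (vbdl C) (tangent_bundle (base C)) (anchor C) \<and>
     real_bilinear_on (sections C) (dorfman C) \<and>
     (\<forall>x\<in>sections C. \<forall>y\<in>sections C. \<forall>z\<in>sections C.
        dorfman C x (dorfman C y z) = dorfman C (dorfman C x y) z + dorfman C y (dorfman C x z)) \<and>
     (\<forall>x\<in>sections C. \<forall>y\<in>sections C.
        anchor C \<cdot> dorfman C x y = lie_bracket (base C) (anchor C \<cdot> x) (anchor C \<cdot> y)) \<and>
     (\<forall>f\<in>smooths C. \<forall>x\<in>sections C. \<forall>y\<in>sections C.
        dorfman C x (f \<odot> y) = anchor_deriv C x f \<odot> y + f \<odot> dorfman C x y) \<and>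
     (\<forall>x\<in>sections C. \<forall>y\<in>sections C.
        dorfman C x y + dorfman C y x = 2 *\<^sub>R grad C (pair C x y)) \<and>
     (\<forall>f\<in>smooths C. \<forall>x\<in>sections C. dorfman C (grad C f) x = 0) \<and>
     (\<forall>x\<in>sections C. \<forall>y\<in>sections C. \<forall>z\<in>sections C.
        anchor_deriv C x (pair C y z) = pair C (dorfman C x y) z + pair C y (dorfman C x z))"

section \<open>Hypercomplex structures and connections\<close>

definition nijenhuis :: "('m, 'e, 'v::real_vector) courant \<Rightarrow> ('m \<Rightarrow> 'v \<Rightarrow> 'v) \<Rightarrow> ('m \<Rightarrow> 'v \<Rightarrow> 'v) \<Rightarrow>
    ('m \<Rightarrow> 'v) \<Rightarrow> ('m \<Rightarrow> 'v) \<Rightarrow> 'm \<Rightarrow> 'v" where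
  "nijenhuis C F G U V =
       dorfman C (F \<cdot> U) (G \<cdot> V) - F \<cdot> dorfman C U (G \<cdot> V) - G \<cdot> dorfman C (F \<cdot> U) V + F \<cdot> G \<cdot> dorfman C U V
     + dorfman C (G \<cdot> U) (F \<cdot> V) - G \<cdot> dorfman C U (F \<cdot> V) - F \<cdot> dorfman C (G \<cdot> U) V + G \<cdot> F \<cdot> dorfman C U V"

definition almost_complex ::
  "('m, 'e::real_normed_vector, 'v::real_vector) courant \<Rightarrow> ('m \<Rightarrow> 'v \<Rightarrow> 'v) \<Rightarrow> bool" where
  "almost_complex C J \<longleftrightarrow>
     bundle_map (base C) (vbdl C) (vbdl C) J \<and>
     (\<forall>p. \<forall>x\<in>fibre (vbdl C) p. \<forall>y\<in>fibre (vbdl C) p.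
        pairing C p (J p x) (J p y) = pairing C p x y) \<and>
     (\<forall>p. \<forall>x\<in>fibre (vbdl C) p. J p (J p x) = - x)"

definition almost_hypercomplex ::
  "('m, 'e::real_normed_vector, 'v::real_vector) courant \<Rightarrow>
   ('m \<Rightarrow> 'v \<Rightarrow> 'v) \<Rightarrow> ('m \<Rightarrow> 'v \<Rightarrow> 'v) \<Rightarrow> ('m \<Rightarrow> 'v \<Rightarrow> 'v) \<Rightarrow> bool" where
  "almost_hypercomplex C I J K \<longleftrightarrow>
     almost_complex C I \<and> almost_complex C J \<and> almost_complex C K \<and>
     (\<forall>p. \<forall>x\<in>fibre (vbdl C) p. I p (J p (K p x)) = - x)"

definition hypercomplex ::
  "('m, 'e::real_normed_vector, 'v::real_vector) courant \<Rightarrow>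
   ('m \<Rightarrow> 'v \<Rightarrow> 'v) \<Rightarrow> ('m \<Rightarrow> 'v \<Rightarrow> 'v) \<Rightarrow> ('m \<Rightarrow> 'v \<Rightarrow> 'v) \<Rightarrow> bool" where
  "hypercomplex C I J K \<longleftrightarrow>
     almost_hypercomplex C I J K \<and>
     (\<forall>U\<in>sections C. \<forall>V\<in>sections C.
        nijenhuis C I I U V = 0 \<and> nijenhuis C I J U V = 0 \<and> nijenhuis C I K U V = 0 \<and>
        nijenhuis C J J U V = 0 \<and> nijenhuis C J K U V = 0 \<and> nijenhuis C K K U V = 0)"

definition triangle :: "('m, 'e, 'v::real_vector) courant \<Rightarrow>
    ('m \<Rightarrow> 'v \<Rightarrow> 'v) \<Rightarrow> ('m \<Rightarrow> 'v \<Rightarrow> 'v) \<Rightarrow> ('m \<Rightarrow> 'v \<Rightarrow> 'v) \<Rightarrow>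
    ('m \<Rightarrow> real) \<Rightarrow> ('m \<Rightarrow> 'v) \<Rightarrow> ('m \<Rightarrow> 'v) \<Rightarrow> 'm \<Rightarrow> 'v" where
  "triangle C I J K f U V =
     pair C U V \<odot> grad C f + pair C (I \<cdot> U) V \<odot> I \<cdot> grad C f
     + pair C (J \<cdot> U) V \<odot> J \<cdot> grad C f + pair C (K \<cdot> U) V \<odot> K \<cdot> grad C f"

text \<open>Connections are extensional functions (\<open>\<rightarrow>\<^sub>E\<close>), so that two of them are equal iff they
  agree on \<open>\<Gamma>(E) \<times> \<Gamma>(E)\<close>.\<close>

definition hypercomplex_connection ::
  "('m, 'e::real_normed_vector, 'v::real_vector) courant \<Rightarrow>
   ('m \<Rightarrow> 'v \<Rightarrow> 'v) \<Rightarrow> ('m \<Rightarrow> 'v \<Rightarrow> 'v) \<Rightarrow> ('m \<Rightarrow> 'v \<Rightarrow> 'v) \<Rightarrow>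
   (('m \<Rightarrow> 'v) \<Rightarrow> ('m \<Rightarrow> 'v) \<Rightarrow> 'm \<Rightarrow> 'v) \<Rightarrow> bool" where
  "hypercomplex_connection C I J K nabla \<longleftrightarrow>
     nabla \<in> sections C \<rightarrow>\<^sub>E sections C \<rightarrow>\<^sub>E sections C \<and>
     real_bilinear_on (sections C) nabla \<and>
     (\<forall>f\<in>smooths C. \<forall>U\<in>sections C. \<forall>V\<in>sections C.
        nabla (f \<odot> U) V = f \<odot> nabla U V \<and>
        nabla U (f \<odot> V) = anchor_deriv C U f \<odot> V + f \<odot> nabla U V - triangle C I J K f U V)"

definition torsion :: "('m, 'e, 'v::real_vector) courant \<Rightarrow>
    (('m \<Rightarrow> 'v) \<Rightarrow> ('m \<Rightarrow> 'v) \<Rightarrow> 'm \<Rightarrow> 'v) \<Rightarrow> ('m \<Rightarrow> 'v) \<Rightarrow> ('m \<Rightarrow> 'v) \<Rightarrow> 'm \<Rightarrow> 'v" where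
  "torsion C nabla U V = nabla U V - nabla V U - (1/2) *\<^sub>R (dorfman C U V - dorfman C V U)"

definition parallel :: "('m, 'e::real_normed_vector, 'v::real_vector) courant \<Rightarrow>
    (('m \<Rightarrow> 'v) \<Rightarrow> ('m \<Rightarrow> 'v) \<Rightarrow> 'm \<Rightarrow> 'v) \<Rightarrow> ('m \<Rightarrow> 'v \<Rightarrow> 'v) \<Rightarrow> bool" where
  "parallel C nabla F \<longleftrightarrow> (\<forall>U\<in>sections C. \<forall>V\<in>sections C. nabla U (F \<cdot> V) = F \<cdot> nabla U V)"

end

theory Submission
  imports Defs
begin

text \<open>
  The theorem separates into an algebraic part, in which the sections form a mere vector space
  with a quaternionic action and a bilinear operation, and an analytic part, which says how the
  formula for the connection depends on multiplication by functions.

  Algebra. The axiom \<open>U \<circ> V + V \<circ> U = 2\<D>\<langle>U, V\<rangle>\<close> says that \<open>\<D>\<langle>U, V\<rangle>\<close> is the symmetric part of the bracket,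
  so that the torsion condition involves the bracket alone. Together with this axiom it expresses
  \<open>U \<circ> V\<close> as \<open>\<nabla>\<^sub>U V - \<nabla>\<^sub>V U\<close> plus a term \<open>Q(U, V)\<close> which satisfies \<open>Q(U, IV) = I Q(U, V)\<close>. Inserting this into
  \<open>JV \<circ> IU - J(V \<circ> IU) - I(JV \<circ> U) + JI(V \<circ> U)\<close> with \<open>I\<close> and \<open>J\<close> parallel, all terms cancel except
  \<open>2K\<nabla>\<^sub>U V\<close>: this is uniqueness, together with the formula (\<open>connection_unique\<close>).
  For existence, put \<open>\<delta>\<^sub>F V (U) = FV \<circ> U - F(V \<circ> U)\<close>. Then \<open>\<N>(F, G)(V, U) = [\<delta>\<^sub>F V, G] U + [\<delta>\<^sub>G V, F] U\<close>
  whatever \<open>F\<close> and \<open>G\<close>, and the formula reads \<open>\<nabla>\<^sub>U V = - V \<circ> U - K[\<delta>\<^sub>J V, I] U / 2\<close>. In this form the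
  parallelism of \<open>I\<close> is a short consequence of the vanishing of \<open>\<N>(I, I)\<close>, \<open>\<N>(I, J)\<close> and \<open>\<N>(I, K)\<close>
  (\<open>connection_I\<close>). The parallelism of \<open>J\<close> is an identity, and \<open>K = IJ\<close>. The torsion is computed from
  \<open>\<N>(I, I) = \<N>(J, J) = \<N>(K, K) = 0\<close> and the symmetric part of the bracket (\<open>connection_torsion\<close>).

  Analysis. The Leibniz rule in the second argument of the bracket is an axiom, the one in the first
  argument follows from it, from the symmetric part and from \<open>\<D>(fg) = f \<D>g + g \<D>f\<close>
  (\<open>dorfman_fscale_left\<close>). In the formula for \<open>\<nabla>\<^sub>U V\<close> the derivatives of \<open>f\<close> cancel when \<open>U\<close> is
  multiplied by \<open>f\<close>. When \<open>V\<close> is multiplied by \<open>f\<close>, they add up to \<open>(\<rho>(U)f) V\<close>, and the four terms with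
  \<open>\<D>f\<close> are those of \<open>- \<triangle>\<^sub>f(U, V)\<close>.

  These computations rest on facts that are tacit in the usual presentation: sections are preserved
  by bundle maps and by multiplication with smooth functions, the function \<open>\<langle>U, V\<rangle>\<close> is smooth, and
  \<open>\<D>f\<close> exists. The first two hold over each local frame, hence globally because smoothness can be
  tested on an open cover. The last is the Riesz representation for a nondegenerate form on the
  finite-dimensional fibres.
\<close>

section \<open>Quaternionic actions and brackets\<close>

text \<open>The operators act on a subspace \<open>S\<close> and may be arbitrary outside of it. The instances are
  single fibres and spaces of sections, which are subspaces of larger function spaces.\<close>

locale quaternionic =
  fixes S :: "'a::real_vector set" and I J K :: "'a \<Rightarrow> 'a"
  assumes subspace: "subspace S"
    and closed: "\<And>x. x \<in> S \<Longrightarrow> I x \<in> S" "\<And>x. x \<in> S \<Longrightarrow> J x \<in> S" "\<And>x. x \<in> S \<Longrightarrow> K x \<in> S"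
    and additive: "\<And>x y. x \<in> S \<Longrightarrow> y \<in> S \<Longrightarrow> I (x + y) = I x + I y"
      "\<And>x y. x \<in> S \<Longrightarrow> y \<in> S \<Longrightarrow> J (x + y) = J x + J y"
      "\<And>x y. x \<in> S \<Longrightarrow> y \<in> S \<Longrightarrow> K (x + y) = K x + K y"
    and homogeneous: "\<And>c x. x \<in> S \<Longrightarrow> I (c *\<^sub>R x) = c *\<^sub>R I x"
      "\<And>c x. x \<in> S \<Longrightarrow> J (c *\<^sub>R x) = c *\<^sub>R J x"
      "\<And>c x. x \<in> S \<Longrightarrow> K (c *\<^sub>R x) = c *\<^sub>R K x"
    and squares: "\<And>x. x \<in> S \<Longrightarrow> I (I x) = - x" "\<And>x. x \<in> S \<Longrightarrow> J (J x) = - x"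
      "\<And>x. x \<in> S \<Longrightarrow> K (K x) = - x"
    and IJK: "\<And>x. x \<in> S \<Longrightarrow> I (J (K x)) = - x"
begin

lemma mem:
  "0 \<in> S" "x \<in> S \<Longrightarrow> y \<in> S \<Longrightarrow> x + y \<in> S" "x \<in> S \<Longrightarrow> y \<in> S \<Longrightarrow> x - y \<in> S"
  "x \<in> S \<Longrightarrow> - x \<in> S" "x \<in> S \<Longrightarrow> c *\<^sub>R x \<in> S"
  using subspace by (auto simp: subspace_def subspace_diff subspace_neg)

lemma minus:
  "x \<in> S \<Longrightarrow> I (- x) = - I x" "x \<in> S \<Longrightarrow> J (- x) = - J x" "x \<in> S \<Longrightarrow> K (- x) = - K x"
  using homogeneous[of x "-1"] by simp_all

lemma diff:
  assumes "x \<in> S" "y \<in> S"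
  shows "I (x - y) = I x - I y" "J (x - y) = J x - J y" "K (x - y) = K x - K y"
  using additive[of x "- y"] assms by (simp_all add: mem minus)

lemma products:
  assumes x: "x \<in> S"
  shows "I (J x) = K x" "J (K x) = I x" "K (I x) = J x"
    "J (I x) = - K x" "K (J x) = - I x" "I (K x) = - J x"
proof -
  have IJ: "I (J y) = K y" if "y \<in> S" for y
    using IJK[of "K y"] that by (simp add: squares minus closed)
  have JK: "J (K y) = I y" if "y \<in> S" for y
    using arg_cong[OF IJK[OF that], of I] that by (simp add: squares minus closed)
  have KJ: "K (J y) = - I y" if "y \<in> S" for y
    using IJ[of "J y"] that by (simp add: squares minus closed)
  have IK: "I (K y) = - J y" if "y \<in> S" for y
    using arg_cong[OF IJ[OF that], of I] that by (simp add: squares minus closed)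
  show "I (J x) = K x" "J (K x) = I x" "K (J x) = - I x" "I (K x) = - J x"
    using x by (simp_all add: IJ JK KJ IK)
  show "J (I x) = - K x"
    using arg_cong[OF JK[OF x], of J] x by (simp add: squares closed minus)
  show "K (I x) = J x"
    using arg_cong[OF KJ[OF x], of K] x by (simp add: squares closed minus)
qed

text \<open>As rewrite rules these bring every word in \<open>I\<close>, \<open>J\<close>, \<open>K\<close> applied to a linear combination into the
  form of a linear combination of terms with at most one operator each. Quaternionic identities are
  then identities in the vector space.\<close>

lemmas normalise = closed mem additive homogeneous minus diff squares products

end

definition nijenhuis_concomitant :: "('a::real_vector \<Rightarrow> 'a \<Rightarrow> 'a) \<Rightarrow> ('a \<Rightarrow> 'a) \<Rightarrow> ('a \<Rightarrow> 'a) \<Rightarrow> 'a \<Rightarrow> 'a \<Rightarrow> 'a" where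
  "nijenhuis_concomitant B F G x y = B (F x) (G y) - F (B x (G y)) - G (B (F x) y) + F (G (B x y))
     + B (G x) (F y) - G (B x (F y)) - F (B (G x) y) + G (F (B x y))"

text \<open>The part of a hypercomplex Courant algebroid that lives on sections without reference to
  functions. Invariance of the pairing under \<open>I\<close> enters as invariance of the symmetric
  part of the bracket.\<close>

locale hypercomplex_bracket = quaternionic S I J K for S :: "'a::real_vector set" and I J K +
  fixes B :: "'a \<Rightarrow> 'a \<Rightarrow> 'a"
  assumes bilinear: "real_bilinear_on S B"
    and invariant: "\<And>x y. x \<in> S \<Longrightarrow> y \<in> S \<Longrightarrow> B (I x) (I y) + B (I y) (I x) = B x y + B y x"
    and integrable: "\<And>x y. x \<in> S \<Longrightarrow> y \<in> S \<Longrightarrow> nijenhuis_concomitant B I I x y = 0"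
      "\<And>x y. x \<in> S \<Longrightarrow> y \<in> S \<Longrightarrow> nijenhuis_concomitant B J J x y = 0"
      "\<And>x y. x \<in> S \<Longrightarrow> y \<in> S \<Longrightarrow> nijenhuis_concomitant B K K x y = 0"
      "\<And>x y. x \<in> S \<Longrightarrow> y \<in> S \<Longrightarrow> nijenhuis_concomitant B I J x y = 0"
      "\<And>x y. x \<in> S \<Longrightarrow> y \<in> S \<Longrightarrow> nijenhuis_concomitant B I K x y = 0"
begin

definition connection :: "'a \<Rightarrow> 'a \<Rightarrow> 'a" where
  "connection x y = - ((1/2) *\<^sub>R K (B (J y) (I x) - J (B y (I x)) - I (B (J y) x) + J (I (B y x))))"

text \<open>For the Dorfman bracket this is \<open>\<D>\<langle>x, y\<rangle>\<close>.\<close>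

definition sym :: "'a \<Rightarrow> 'a \<Rightarrow> 'a" where
  "sym x y = (1/2) *\<^sub>R (B x y + B y x)"

lemma B_mem: "x \<in> S \<Longrightarrow> y \<in> S \<Longrightarrow> B x y \<in> S"
  using bilinear by (auto simp: real_bilinear_on_def)

lemma B_linear:
  "x \<in> S \<Longrightarrow> y \<in> S \<Longrightarrow> z \<in> S \<Longrightarrow> B (x + y) z = B x z + B y z"
  "x \<in> S \<Longrightarrow> y \<in> S \<Longrightarrow> z \<in> S \<Longrightarrow> B z (x + y) = B z x + B z y"
  "x \<in> S \<Longrightarrow> y \<in> S \<Longrightarrow> B (c *\<^sub>R x) y = c *\<^sub>R B x y"
  "x \<in> S \<Longrightarrow> y \<in> S \<Longrightarrow> B x (c *\<^sub>R y) = c *\<^sub>R B x y"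
  using bilinear by (auto simp: real_bilinear_on_def)

lemma B_minus:
  assumes "x \<in> S" "y \<in> S" shows "B (- x) y = - B x y" "B x (- y) = - B x y"
  using B_linear(3,4)[of x y "-1"] assms by simp_all

lemmas B_normalise = normalise B_mem B_linear B_minus

lemma connection_mem: "x \<in> S \<Longrightarrow> y \<in> S \<Longrightarrow> connection x y \<in> S"
  by (simp add: connection_def B_normalise)

lemma connection_bilinear: "real_bilinear_on S connection"
  unfolding real_bilinear_on_def
  by (simp add: connection_mem) (simp add: connection_def B_normalise algebra_simps)

text \<open>Replacing \<open>y\<close> by \<open>J y\<close> interchanges the brackets with \<open>y\<close> and those with \<open>J y\<close>, up to sign. The
  coefficients match because \<open>J\<^sup>2 = -1\<close> and \<open>J\<close> anticommutes with \<open>I\<close> and \<open>K\<close>.\<close>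

lemma connection_J:
  assumes "x \<in> S" "y \<in> S"
  shows "connection x (J y) = J (connection x y)"
  using assms by (simp add: connection_def B_normalise algebra_simps)

text \<open>The failure of \<open>y \<mapsto> B y\<close> to commute with \<open>F\<close>. The concomitant of \<open>F\<close> and \<open>G\<close> is the sum of the
  commutators of \<open>\<delta> F y\<close> with \<open>G\<close> and of \<open>\<delta> G y\<close> with \<open>F\<close>.\<close>

definition \<delta> :: "('a \<Rightarrow> 'a) \<Rightarrow> 'a \<Rightarrow> 'a \<Rightarrow> 'a" where
  "\<delta> F y x = B (F y) x - F (B y x)"

text \<open>By \<open>\<N>(I, I) = 0\<close> the operator \<open>\<delta> I y\<close> commutes with \<open>I\<close>. By \<open>\<N>(I, J) = 0\<close> and \<open>\<N>(I, K) = 0\<close> the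
  commutators of \<open>\<delta> J y\<close> and \<open>\<delta> K y\<close> with \<open>I\<close> are minus those of \<open>\<delta> I y\<close> with \<open>J\<close> and \<open>K\<close>. Both sides
  of the claim are thus expressed by \<open>\<delta> I y\<close> besides \<open>B (I y) x\<close> and \<open>I (B y x)\<close>, and comparing them
  leaves the definition of \<open>\<delta> I y x\<close>.\<close>

lemma connection_I:
  assumes x: "x \<in> S" and y: "y \<in> S"
  shows "connection x (I y) = I (connection x y)"
proof -
  have mem_\<delta>: "\<delta> I y z \<in> S" "\<delta> J y z \<in> S" "\<delta> K y z \<in> S" if "z \<in> S" for z
    using that y by (simp_all add: \<delta>_def B_normalise)
  have II: "\<delta> I y (I z) = I (\<delta> I y z)" if z: "z \<in> S" for z
  proof -
    have "2 *\<^sub>R (\<delta> I y (I z) - I (\<delta> I y z)) = nijenhuis_concomitant B I I y z"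
      using y z by (simp add: nijenhuis_concomitant_def \<delta>_def B_normalise algebra_simps scaleR_2)
    then show ?thesis using integrable(1)[OF y z] by simp
  qed
  have IJ: "\<delta> J y (I x) - I (\<delta> J y x) = J (\<delta> I y x) - \<delta> I y (J x)"
    using integrable(4)[OF y x] x y
    by (simp add: nijenhuis_concomitant_def \<delta>_def B_normalise algebra_simps)
  have IK: "\<delta> K y (I x) - I (\<delta> K y x) = K (\<delta> I y x) - \<delta> I y (K x)"
    using integrable(5)[OF y x] x y
    by (simp add: nijenhuis_concomitant_def \<delta>_def B_normalise algebra_simps)
  \<comment> \<open>the product rule \<open>\<delta> (F G) y z = \<delta> F (G y) z + F (\<delta> G y z)\<close> for \<open>J I = - K\<close>\<close>
  have comp: "\<delta> J (I y) z = - \<delta> K y z - J (\<delta> I y z)" if "z \<in> S" for z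
    using y that by (simp add: \<delta>_def B_normalise algebra_simps)
  have conn: "connection x w = - B w x - (1/2) *\<^sub>R K (\<delta> J w (I x) - I (\<delta> J w x))" if "w \<in> S" for w
    using x that by (simp add: connection_def \<delta>_def B_normalise algebra_simps
        flip: scaleR_left_distrib)
  have 1: "connection x (I y) = - B (I y) x - (1/2) *\<^sub>R J (\<delta> I y (J x)) + (1/2) *\<^sub>R \<delta> I y x"
  proof -
    have "\<delta> J (I y) (I x) - I (\<delta> J (I y) x)
        = - (\<delta> K y (I x) - I (\<delta> K y x)) - J (\<delta> I y (I x)) + K (\<delta> I y x)"
      using x y by (simp add: comp II normalise mem_\<delta>)
    also have "\<dots> = \<delta> I y (K x) + K (\<delta> I y x)"
      using x y by (simp add: IK II normalise mem_\<delta>)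
    \<comment> \<open>\<open>K = IJ\<close> and \<open>\<delta> I y\<close> commutes with \<open>I\<close>; then \<open>KI = J\<close> gives the term with \<open>J\<close>\<close>
    also have "\<delta> I y (K x) = I (\<delta> I y (J x))"
      using II[of "J x"] x by (simp add: normalise)
    finally show ?thesis
      using x y by (simp add: conn normalise mem_\<delta> algebra_simps)
  qed
  have 2: "I (connection x y) = - I (B y x) - (1/2) *\<^sub>R J (\<delta> I y (J x)) - (1/2) *\<^sub>R \<delta> I y x"
    using x y by (simp add: conn IJ normalise mem_\<delta> B_mem algebra_simps)
  have "connection x (I y) - I (connection x y)
      = I (B y x) - B (I y) x + ((1/2) *\<^sub>R \<delta> I y x + (1/2) *\<^sub>R \<delta> I y x)"
    unfolding 1 2 by simp
  also have "(1/2) *\<^sub>R \<delta> I y x + (1/2) *\<^sub>R \<delta> I y x = \<delta> I y x"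
    by (simp flip: scaleR_left_distrib)
  finally show ?thesis
    by (simp add: \<delta>_def)
qed

lemma connection_K:
  assumes "x \<in> S" "y \<in> S"
  shows "connection x (K y) = K (connection x y)"
  using connection_I[of x "J y"] connection_J[of x y] assms
  by (simp add: normalise connection_mem)

lemma sym_commute: "sym x y = sym y x"
  by (simp add: sym_def add.commute)

lemma sym_mem: "x \<in> S \<Longrightarrow> y \<in> S \<Longrightarrow> sym x y \<in> S"
  by (simp add: sym_def B_normalise)

lemma sym_minus: "x \<in> S \<Longrightarrow> y \<in> S \<Longrightarrow> sym x (- y) = - sym x y"
  by (simp add: sym_def B_normalise scaleR_right_distrib scaleR_right_diff_distrib)

lemma sym_I_skew:
  assumes "x \<in> S" "y \<in> S"
  shows "sym (I x) y = - sym x (I y)"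
proof -
  have "sym (I x) (I (I y)) = sym x (I y)"
    using assms invariant[of x "I y"] by (simp add: sym_def closed)
  then have "- sym (I x) y = sym x (I y)"
    using assms by (simp add: squares sym_minus closed)
  then show ?thesis by (simp flip: minus_equation_iff)
qed

lemma B_swap: "B x y = 2 *\<^sub>R sym x y - B y x"
  by (simp add: sym_def)

text \<open>In the skew part of the formula, the arguments of three brackets are exchanged at the cost of
  symmetric terms, which give the right-hand side. What remains contains only sums
  \<open>B (F u) v + B u (F v)\<close>, and these are governed by \<open>\<N>(F, F) = 0\<close>. The one with \<open>I\<close> and \<open>J\<close> mixed is of
  this type too, with \<open>F = K\<close>, because \<open>J x = K (I x)\<close>.\<close>

lemma connection_torsion:
  assumes x: "x \<in> S" and y: "y \<in> S"
  shows "connection x y - connection y x - (1/2) *\<^sub>R (B x y - B y x)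
    = I (sym x (I y)) + J (sym x (J y)) + K (sym x (K y))"
proof -
  note nf = x y B_normalise sym_mem sym_minus algebra_simps
  have square: "F (B (F u) v + B u (F v)) = B (F u) (F v) - B u v"
    if "F \<in> {I, J, K}" and u: "u \<in> S" and v: "v \<in> S" for F u v
  proof -
    have "2 *\<^sub>R (B (F u) (F v) - B u v - F (B (F u) v + B u (F v))) = nijenhuis_concomitant B F F u v"
      using that by (auto simp: nijenhuis_concomitant_def B_normalise algebra_simps scaleR_2)
    then show ?thesis using integrable that by auto
  qed
  have KK: "K (B (I x) (J y) + B (J x) (I y)) = B (J x) (J y) - B (I x) (I y)"
    using square[of K "I x" "I y"] x y by (simp add: normalise add.commute)
  have "2 *\<^sub>R (connection x y - connection y x - (1/2) *\<^sub>R (B x y - B y x))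
     = - K (B (J y) (I x) - B (J x) (I y)) - I (B y (I x) - B x (I y)) + J (B (J y) x - B (J x) y)"
    by (simp add: connection_def nf scaleR_2 flip: scaleR_left_distrib)
  also have "B (J y) (I x) = - (2 *\<^sub>R sym x (K y)) - B (I x) (J y)"
    using x y sym_I_skew[of x "J y"] by (subst B_swap) (simp add: sym_commute[of "J y"] nf)
  also have "B y (I x) = - (2 *\<^sub>R sym x (I y)) - B (I x) y"
    using x y sym_I_skew[of x y] by (subst B_swap) (simp add: sym_commute[of y] nf)
  also have "B (J y) x = 2 *\<^sub>R sym x (J y) - B x (J y)"
    by (subst B_swap) (simp add: sym_commute[of "J y"])
  also have "- K (- (2 *\<^sub>R sym x (K y)) - B (I x) (J y) - B (J x) (I y))
       - I (- (2 *\<^sub>R sym x (I y)) - B (I x) y - B x (I y))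
       + J (2 *\<^sub>R sym x (J y) - B x (J y) - B (J x) y)
     = 2 *\<^sub>R (I (sym x (I y)) + J (sym x (J y)) + K (sym x (K y)))
       + K (B (I x) (J y) + B (J x) (I y)) + I (B (I x) y + B x (I y)) - J (B (J x) y + B x (J y))"
    by (simp add: nf)
  also have "\<dots> = 2 *\<^sub>R (I (sym x (I y)) + J (sym x (J y)) + K (sym x (K y)))"
    using x y by (simp add: KK square)
  finally show ?thesis by simp
qed

text \<open>The map \<open>Q\<close> below collects what the torsion condition adds to \<open>D u v - D v u\<close> in \<open>B u v\<close>. It is
  \<open>I\<close>-linear in its second argument, so it cancels in pairs in the formula, as do all terms with \<open>D\<close>
  except \<open>I J (D x y) - J I (D x y)\<close>.\<close>

lemma connection_unique:
  assumes mem': "\<And>x y. x \<in> S \<Longrightarrow> y \<in> S \<Longrightarrow> D x y \<in> S"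
    and par: "\<And>x y. x \<in> S \<Longrightarrow> y \<in> S \<Longrightarrow> D x (I y) = I (D x y)"
      "\<And>x y. x \<in> S \<Longrightarrow> y \<in> S \<Longrightarrow> D x (J y) = J (D x y)"
    and tors: "\<And>x y. x \<in> S \<Longrightarrow> y \<in> S \<Longrightarrow> D x y - D y x - (1/2) *\<^sub>R (B x y - B y x)
      = I (sym x (I y)) + J (sym x (J y)) + K (sym x (K y))"
    and x: "x \<in> S" and y: "y \<in> S"
  shows "D x y = connection x y"
proof -
  define Q where "Q u v = sym u v - I (sym u (I v)) - J (sym u (J v)) - K (sym u (K v))" for u v
  have memQ: "Q u v \<in> S" if "u \<in> S" "v \<in> S" for u v
    using that by (simp add: Q_def normalise sym_mem)
  have B_eq: "B u v = D u v - D v u + Q u v" if u: "u \<in> S" and v: "v \<in> S" for u v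
  proof -
    have "B u v = (1/2) *\<^sub>R (B u v - B v u) + sym u v"
      by (simp add: sym_def algebra_simps flip: scaleR_left_distrib)
    also have "(1/2) *\<^sub>R (B u v - B v u)
        = D u v - D v u - (I (sym u (I v)) + J (sym u (J v)) + K (sym u (K v)))"
      unfolding tors[OF u v, symmetric] by simp
    finally show ?thesis by (simp add: Q_def)
  qed
  have Q_I: "Q u (I v) = I (Q u v)" if "u \<in> S" "v \<in> S" for u v
    using that by (simp add: Q_def normalise sym_mem sym_minus)
  have "B (J y) (I x) - J (B y (I x)) - I (B (J y) x) + J (I (B y x)) = 2 *\<^sub>R K (D x y)"
    using x y by (simp add: B_eq Q_I memQ mem' par normalise scaleR_2)
  then show ?thesis
    using x y by (simp add: connection_def normalise mem')
qed

end

section \<open>Smooth functions on open subsets of a normed space\<close>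

lemma C_on_subset: "C_on k S f \<Longrightarrow> T \<subseteq> S \<Longrightarrow> C_on k T f"
  by (induction k arbitrary: f) (auto intro: continuous_on_subset, blast)

lemma C_on_cong:
  assumes "open S" "C_on k S f" "\<And>x. x \<in> S \<Longrightarrow> f x = g x"
  shows "C_on k S g"
proof (cases k)
  case 0
  then show ?thesis using assms by (simp cong: continuous_on_cong)
next
  case (Suc n)
  then obtain f' where f': "\<And>x. x \<in> S \<Longrightarrow> (f has_derivative f' x) (at x)"
      "\<And>v. C_on n S (\<lambda>x. f' x v)"
    using assms(2) by auto
  moreover have "(g has_derivative f' x) (at x)" if "x \<in> S" for x
    using has_derivative_transform_within_open[OF f'(1) assms(1)] that assms(3) by blast
  ultimately show ?thesis using Suc by auto
qed

lemma C_on_SucD: "C_on (Suc k) S f \<Longrightarrow> C_on k S f"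
proof (induction k arbitrary: f)
  case 0
  then obtain f' where "\<forall>x\<in>S. (f has_derivative f' x) (at x)" by auto
  then show ?case
    by (auto intro!: continuous_at_imp_continuous_on dest: has_derivative_continuous)
next
  case (Suc k)
  then obtain f' where "\<forall>x\<in>S. (f has_derivative f' x) (at x)" "\<forall>v. C_on (Suc k) S (\<lambda>x. f' x v)"
    by (subst (asm) C_on.simps(2)) blast
  then show ?case using Suc.IH by (subst C_on.simps(2)) blast
qed

lemma C_on_const: "C_on k S (\<lambda>x. c)"
proof (induction k arbitrary: c)
  case (Suc k)
  then show ?case by (auto intro!: exI[of _ "\<lambda>x v. 0"])
qed simp

lemma C_on_add: "C_on k S f \<Longrightarrow> C_on k S g \<Longrightarrow> C_on k S (\<lambda>x. f x + g x)"
proof (induction k arbitrary: f g)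
  case 0
  then show ?case by (auto intro: continuous_on_add)
next
  case (Suc k)
  then obtain f' g' where
      "\<forall>x\<in>S. (f has_derivative f' x) (at x)" "\<forall>v. C_on k S (\<lambda>x. f' x v)"
      "\<forall>x\<in>S. (g has_derivative g' x) (at x)" "\<forall>v. C_on k S (\<lambda>x. g' x v)"
    by auto
  then show ?case using Suc.IH
    by (auto intro!: exI[of _ "\<lambda>x v. f' x v + g' x v"] has_derivative_add)
qed

lemma C_on_mult:
  fixes f g :: "'a::real_normed_vector \<Rightarrow> real"
  shows "C_on k S f \<Longrightarrow> C_on k S g \<Longrightarrow> C_on k S (\<lambda>x. f x * g x)"
proof (induction k arbitrary: f g)
  case 0
  then show ?case by (auto intro: continuous_on_mult)
next
  case (Suc k)
  then obtain f' g' where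
      "\<forall>x\<in>S. (f has_derivative f' x) (at x)" "\<forall>v. C_on k S (\<lambda>x. f' x v)"
      "\<forall>x\<in>S. (g has_derivative g' x) (at x)" "\<forall>v. C_on k S (\<lambda>x. g' x v)"
    by auto
  moreover have "C_on k S f" "C_on k S g"
    using Suc.prems by (blast dest: C_on_SucD)+
  ultimately show ?case using Suc.IH
    by (auto intro!: exI[of _ "\<lambda>x v. f x * g' x v + f' x v * g x"] has_derivative_mult C_on_add)
qed

text \<open>Derivatives found on different members of the cover agree on overlaps, as they are all equal to
  the Frechet derivative.\<close>

lemma C_on_Union:
  assumes "\<And>S. S \<in> \<S> \<Longrightarrow> open S" "\<And>S. S \<in> \<S> \<Longrightarrow> C_on k S f"
  shows "C_on k (\<Union>\<S>) f"
  using assms(2)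
proof (induction k arbitrary: f)
  case 0
  then show ?case using assms(1) by (auto intro!: continuous_on_open_Union)
next
  case (Suc k)
  define f' where "f' x = frechet_derivative f (at x)" for x
  have deriv: "(f has_derivative f' x) (at x)" if "x \<in> S" "S \<in> \<S>" for x S
    using Suc.prems[OF that(2)] that(1) unfolding f'_def
    by (auto simp: frechet_derivative_works[symmetric] differentiable_def)
  have "C_on k S (\<lambda>x. f' x v)" if S: "S \<in> \<S>" for S v
  proof -
    obtain f'' where f'': "\<forall>x\<in>S. (f has_derivative f'' x) (at x)" "C_on k S (\<lambda>x. f'' x v)"
      using Suc.prems[OF S] by auto
    then have "f'' x v = f' x v" if "x \<in> S" for x
      using that frechet_derivative_at[of f "f'' x" x] by (simp add: f'_def)
    with C_on_cong[OF assms(1)[OF S] f''(2)] show ?thesis by auto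
  qed
  then have "C_on k (\<Union>\<S>) (\<lambda>x. f' x v)" for v
    by (rule Suc.IH)
  with deriv show ?case by (auto intro!: exI[of _ f'])
qed

section \<open>Smooth functions on a manifold\<close>

locale smooth_atlas =
  fixes A :: "('m::{t2_space,second_countable_topology}, 'e::real_normed_vector) atlas"
  assumes manifold: "smooth_manifold A"
begin

lemma open_chart_image:
  assumes "(W,\<phi>) \<in> A" "open U"
  shows "open (\<phi> ` (U \<inter> W))"
proof -
  have W: "open W" "inj_on \<phi> W" "open (\<phi> ` W)" "homeomorphism W (\<phi> ` W) \<phi> (inv_into W \<phi>)"
    using manifold assms(1) by (auto simp: smooth_manifold_def)
  have "open (\<phi> ` W \<inter> inv_into W \<phi> -` U)"
    using W assms(2) by (auto simp: homeomorphism_def intro!: continuous_open_preimage)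
  also have "\<phi> ` W \<inter> inv_into W \<phi> -` U = \<phi> ` (U \<inter> W)"
    using W(2) by (auto simp: inv_into_f_f)
  finally show ?thesis .
qed

lemma inv_chart: "(W,\<phi>) \<in> A \<Longrightarrow> x \<in> \<phi> ` (U \<inter> W) \<Longrightarrow> inv_into W \<phi> x \<in> U"
  using manifold by (auto simp: smooth_manifold_def inv_into_f_f)

lemma smooth_fun_on_cong:
  assumes "open U" "smooth_fun_on A U f" "\<And>p. p \<in> U \<Longrightarrow> f p = g p"
  shows "smooth_fun_on A U g"
  unfolding smooth_fun_on_def smooth_on_def
proof safe
  fix W \<phi> k assume W: "(W,\<phi>) \<in> A"
  have "C_on k (\<phi> ` (U \<inter> W)) (f \<circ> inv_into W \<phi>)"
    using assms(2) W by (auto simp: smooth_fun_on_def smooth_on_def)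
  then show "C_on k (\<phi> ` (U \<inter> W)) (g \<circ> inv_into W \<phi>)"
    by (rule C_on_cong[OF open_chart_image[OF W assms(1)]]) (use inv_chart[OF W] assms(3) in auto)
qed

lemma smooth_fun_on_subset: "smooth_fun_on A U f \<Longrightarrow> V \<subseteq> U \<Longrightarrow> smooth_fun_on A V f"
  unfolding smooth_fun_on_def smooth_on_def
  by (safe, rule C_on_subset) auto

lemma smooth_fun_on_const: "smooth_fun_on A U (\<lambda>p. c)"
  by (auto simp: smooth_fun_on_def smooth_on_def comp_def C_on_const)

lemma smooth_fun_on_add:
  "smooth_fun_on A U f \<Longrightarrow> smooth_fun_on A U g \<Longrightarrow> smooth_fun_on A U (\<lambda>p. f p + g p)"
  by (fastforce simp: smooth_fun_on_def smooth_on_def comp_def intro: C_on_add)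

lemma smooth_fun_on_mult:
  "smooth_fun_on A U f \<Longrightarrow> smooth_fun_on A U g \<Longrightarrow> smooth_fun_on A U (\<lambda>p. f p * g p)"
  by (fastforce simp: smooth_fun_on_def smooth_on_def comp_def intro: C_on_mult)

lemma smooth_fun_on_sum:
  "(\<And>i. i \<in> X \<Longrightarrow> smooth_fun_on A U (f i)) \<Longrightarrow> smooth_fun_on A U (\<lambda>p. \<Sum>i\<in>X. f i p)"
  by (induction X rule: infinite_finite_induct)
    (simp_all add: smooth_fun_on_const smooth_fun_on_add)

lemma smooth_fun_on_Union:
  assumes "\<And>U. U \<in> \<U> \<Longrightarrow> open U" "\<And>U. U \<in> \<U> \<Longrightarrow> smooth_fun_on A U f"
  shows "smooth_fun_on A (\<Union>\<U>) f"
  unfolding smooth_fun_on_def smooth_on_def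
proof safe
  fix W \<phi> k assume W: "(W,\<phi>) \<in> A"
  have "C_on k (\<phi> ` (U \<inter> W)) (f \<circ> inv_into W \<phi>)" if "U \<in> \<U>" for U
    using assms(2)[OF that] W by (auto simp: smooth_fun_on_def smooth_on_def)
  then have "C_on k (\<Union>U\<in>\<U>. \<phi> ` (U \<inter> W)) (f \<circ> inv_into W \<phi>)"
    using open_chart_image[OF W] assms(1) by (intro C_on_Union) auto
  also have "(\<Union>U\<in>\<U>. \<phi> ` (U \<inter> W)) = \<phi> ` (\<Union>\<U> \<inter> W)" by auto
  finally show "C_on k (\<phi> ` (\<Union>\<U> \<inter> W)) (f \<circ> inv_into W \<phi>)" .
qed

end

section \<open>Sections of a vector bundle\<close>

lemma list_independent_unique:
  fixes vs :: "'v::real_vector list"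
  assumes "distinct vs" "independent (set vs)"
    and eq: "(\<Sum>i<length vs. a i *\<^sub>R vs ! i) = (\<Sum>i<length vs. b i *\<^sub>R vs ! i)"
    and k: "k < length vs"
  shows "a k = b k"
proof -
  define u where "u v = (let i = (THE i. i < length vs \<and> vs ! i = v) in a i - b i)" for v
  have the: "(THE j. j < length vs \<and> vs ! j = vs ! i) = i" if "i < length vs" for i
    using assms(1) that by (intro the_equality) (auto simp: nth_eq_iff_index_eq)
  have "(\<Sum>v\<in>set vs. u v *\<^sub>R v) = (\<Sum>i<length vs. u (vs ! i) *\<^sub>R vs ! i)"
    by (rule sum.reindex_bij_betw[OF bij_betw_nth[OF assms(1)], symmetric]) auto
  also have "\<dots> = (\<Sum>i<length vs. (a i - b i) *\<^sub>R vs ! i)"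
    by (rule sum.cong) (auto simp: u_def the)
  also have "\<dots> = 0" using eq by (simp add: scaleR_left_diff_distrib sum_subtractf)
  finally have "u (vs ! k) = 0"
    using independentD[OF assms(2), of "set vs" u "vs ! k"] k by simp
  then show ?thesis using the[OF k] by (simp add: u_def)
qed

locale vector_bundle = smooth_atlas A
  for A :: "('m::{t2_space,second_countable_topology}, 'e::real_normed_vector) atlas" +
  fixes E :: "('m, 'v::real_vector) vbundle"
  assumes vector_bundle: "smooth_vector_bundle A E"
begin

lemma frame:
  assumes "(W,es) \<in> frames E"
  shows "open W" "\<And>e. e \<in> set es \<Longrightarrow> e \<in> sections_on A E W"
    "\<And>p. p \<in> W \<Longrightarrow> distinct (map (\<lambda>e. e p) es)"
    "\<And>p. p \<in> W \<Longrightarrow> independent (set (map (\<lambda>e. e p) es))"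
    "\<And>p. p \<in> W \<Longrightarrow> span (set (map (\<lambda>e. e p) es)) = fibre E p"
proof -
  have "open W \<and> (\<forall>p\<in>W. distinct (map (\<lambda>e. e p) es) \<and> independent ((\<lambda>e. e p) ` set es) \<and>
      span ((\<lambda>e. e p) ` set es) = fibre E p) \<and> (\<forall>e\<in>set es. e \<in> sections_on A E W)"
    using bspec[OF conjunct2[OF conjunct2[OF vector_bundle[unfolded smooth_vector_bundle_def]]] assms]
    by simp
  then show "open W" "\<And>e. e \<in> set es \<Longrightarrow> e \<in> sections_on A E W"
    "\<And>p. p \<in> W \<Longrightarrow> distinct (map (\<lambda>e. e p) es)"
    "\<And>p. p \<in> W \<Longrightarrow> independent (set (map (\<lambda>e. e p) es))"
    "\<And>p. p \<in> W \<Longrightarrow> span (set (map (\<lambda>e. e p) es)) = fibre E p"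
    by simp_all
qed

lemma frame_cover:
  obtains W es where "(W,es) \<in> frames E" "p \<in> W"
proof -
  have "p \<in> (\<Union>(U,es)\<in>frames E. U)"
    using conjunct1[OF vector_bundle[unfolded smooth_vector_bundle_def]] by simp
  then show ?thesis using that by auto
qed

lemma subspace_fibre: "subspace (fibre E p)"
proof -
  obtain W es where "(W,es) \<in> frames E" "p \<in> W" by (rule frame_cover)
  then show ?thesis using frame(5)[of W es p] by (metis subspace_span)
qed

lemma section_coefficients:
  assumes "s \<in> sections_on A E U" "(W,es) \<in> frames E"
  obtains c where "\<And>i. i < length es \<Longrightarrow> smooth_fun_on A (U \<inter> W) (c i)"
    "\<And>p. p \<in> U \<inter> W \<Longrightarrow> s p = (\<Sum>i<length es. c i p *\<^sub>R (es ! i) p)"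
proof -
  have "\<exists>c. (\<forall>i<length es. smooth_fun_on A (U \<inter> W) (c i)) \<and>
      (\<forall>p\<in>U \<inter> W. s p = (\<Sum>i<length es. c i p *\<^sub>R (es ! i) p))"
    using bspec[OF conjunct2[OF assms(1)[unfolded sections_on_def mem_Collect_eq]] assms(2)] by simp
  then show ?thesis using that by blast
qed

lemma sections_on_zero: "(\<lambda>p. 0) \<in> sections_on A E U"
  unfolding sections_on_def
proof safe
  show "0 \<in> fibre E p" for p
    by (rule subspace_0[OF subspace_fibre])
  show "\<exists>c. (\<forall>i<length es. smooth_fun_on A (U \<inter> W) (c i)) \<and>
      (\<forall>p\<in>U \<inter> W. 0 = (\<Sum>i<length es. c i p *\<^sub>R (es ! i) p))" for W and es :: "('m \<Rightarrow> 'v) list"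
    by (rule exI[of _ "\<lambda>i p. 0"]) (simp add: smooth_fun_on_const)
qed

lemma sections_on_add:
  assumes "s \<in> sections_on A E U" "t \<in> sections_on A E U"
  shows "(\<lambda>p. s p + t p) \<in> sections_on A E U"
  unfolding sections_on_def
proof (safe)
  show "s p + t p \<in> fibre E p" if "p \<in> U" for p
    using assms that by (intro subspace_add subspace_fibre) (auto simp: sections_on_def)
  fix W es assume W: "(W,es) \<in> frames E"
  obtain c where "\<And>i. i < length es \<Longrightarrow> smooth_fun_on A (U \<inter> W) (c i)"
    "\<And>p. p \<in> U \<inter> W \<Longrightarrow> s p = (\<Sum>i<length es. c i p *\<^sub>R (es ! i) p)"
    using section_coefficients[OF assms(1) W] by blast
  moreover obtain d where "\<And>i. i < length es \<Longrightarrow> smooth_fun_on A (U \<inter> W) (d i)"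
    "\<And>p. p \<in> U \<inter> W \<Longrightarrow> t p = (\<Sum>i<length es. d i p *\<^sub>R (es ! i) p)"
    using section_coefficients[OF assms(2) W] by blast
  ultimately show "\<exists>c. (\<forall>i<length es. smooth_fun_on A (U \<inter> W) (c i)) \<and>
      (\<forall>p\<in>U \<inter> W. s p + t p = (\<Sum>i<length es. c i p *\<^sub>R (es ! i) p))"
    by (intro exI[of _ "\<lambda>i p. c i p + d i p"])
      (simp add: smooth_fun_on_add scaleR_left_distrib sum.distrib)
qed

lemma sections_on_scale:
  assumes "smooth_fun_on A U f" "s \<in> sections_on A E U"
  shows "(\<lambda>p. f p *\<^sub>R s p) \<in> sections_on A E U"
  unfolding sections_on_def
proof (safe)
  show "f p *\<^sub>R s p \<in> fibre E p" if "p \<in> U" for p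
    using assms that by (intro subspace_scale subspace_fibre) (auto simp: sections_on_def)
  fix W es assume W: "(W,es) \<in> frames E"
  obtain c where "\<And>i. i < length es \<Longrightarrow> smooth_fun_on A (U \<inter> W) (c i)"
    "\<And>p. p \<in> U \<inter> W \<Longrightarrow> s p = (\<Sum>i<length es. c i p *\<^sub>R (es ! i) p)"
    using section_coefficients[OF assms(2) W] by blast
  moreover have "smooth_fun_on A (U \<inter> W) f"
    using assms(1) by (rule smooth_fun_on_subset) simp
  ultimately show "\<exists>c. (\<forall>i<length es. smooth_fun_on A (U \<inter> W) (c i)) \<and>
      (\<forall>p\<in>U \<inter> W. f p *\<^sub>R s p = (\<Sum>i<length es. c i p *\<^sub>R (es ! i) p))"
    by (intro exI[of _ "\<lambda>i p. f p * c i p"])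
      (simp add: smooth_fun_on_mult scaleR_sum_right)
qed

lemma sections_on_sum:
  assumes "\<And>i. i \<in> X \<Longrightarrow> s i \<in> sections_on A E U"
  shows "(\<lambda>p. \<Sum>i\<in>X. s i p) \<in> sections_on A E U"
  using assms by (induction X rule: infinite_finite_induct)
    (simp_all add: sections_on_zero sections_on_add)

lemma sections_on_cong:
  assumes "s \<in> sections_on A E U" "\<And>p. p \<in> U \<Longrightarrow> s p = t p"
  shows "t \<in> sections_on A E U"
  using assms by (simp add: sections_on_def)

text \<open>The coefficients with respect to a frame that are found on different members of the cover agree on
  overlaps, because frames are linearly independent. Hence a pointwise choice of a member of the
  cover gives well-defined coefficients, which are smooth because they are so locally.\<close>

lemma sections_on_Union:
  assumes op: "\<And>U. U \<in> \<U> \<Longrightarrow> open U" and s: "\<And>U. U \<in> \<U> \<Longrightarrow> s \<in> sections_on A E U"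
  shows "s \<in> sections_on A E (\<Union>\<U>)"
  unfolding sections_on_def
proof (safe)
  show "s p \<in> fibre E p" if "p \<in> U" "U \<in> \<U>" for p U
    using s that by (auto simp: sections_on_def)
  fix W es assume W: "(W,es) \<in> frames E"
  have "\<forall>U\<in>\<U>. \<exists>c. (\<forall>i<length es. smooth_fun_on A (U \<inter> W) (c i)) \<and>
      (\<forall>p\<in>U \<inter> W. s p = (\<Sum>i<length es. c i p *\<^sub>R (es ! i) p))"
    using section_coefficients[OF s W] by metis
  then obtain c where
      c: "\<And>U i. U \<in> \<U> \<Longrightarrow> i < length es \<Longrightarrow> smooth_fun_on A (U \<inter> W) (c U i)"
      "\<And>U p. U \<in> \<U> \<Longrightarrow> p \<in> U \<inter> W \<Longrightarrow> s p = (\<Sum>i<length es. c U i p *\<^sub>R (es ! i) p)"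
    by metis
  have "\<forall>p\<in>\<Union>\<U>. \<exists>U. U \<in> \<U> \<and> p \<in> U" by blast
  then obtain V where V: "\<And>p. p \<in> \<Union>\<U> \<Longrightarrow> V p \<in> \<U> \<and> p \<in> V p" by metis
  define d where "d i p = c (V p) i p" for i p
  have agree: "c U i p = d i p" if "U \<in> \<U>" "i < length es" "p \<in> U \<inter> W" for U i p
  proof -
    have Vp: "V p \<in> \<U>" "p \<in> V p" using V[of p] that by auto
    have "(\<Sum>i<length es. c U i p *\<^sub>R (es ! i) p) = (\<Sum>i<length es. c (V p) i p *\<^sub>R (es ! i) p)"
      using c(2)[OF that(1,3)] c(2)[OF Vp(1), of p] Vp that(3) by simp
    then show ?thesis unfolding d_def
      using list_independent_unique[OF frame(3,4)[OF W], of p "\<lambda>i. c U i p" "\<lambda>i. c (V p) i p" i] that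
      by simp
  qed
  have "smooth_fun_on A (\<Union>\<U> \<inter> W) (d i)" if i: "i < length es" for i
  proof -
    have "smooth_fun_on A (U \<inter> W) (d i)" if "U \<in> \<U>" for U
      using smooth_fun_on_cong[OF _ c(1)[OF that i]] op[OF that] frame(1)[OF W] agree[OF that i]
      by (auto simp: open_Int)
    then have "smooth_fun_on A (\<Union>U\<in>\<U>. U \<inter> W) (d i)"
      using op frame(1)[OF W] by (intro smooth_fun_on_Union) auto
    also have "(\<Union>U\<in>\<U>. U \<inter> W) = \<Union>\<U> \<inter> W" by auto
    finally show ?thesis .
  qed
  moreover have "s p = (\<Sum>i<length es. d i p *\<^sub>R (es ! i) p)" if "p \<in> \<Union>\<U> \<inter> W" for p
    unfolding d_def using V[of p] that by (intro c(2)) auto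
  ultimately show "\<exists>c. (\<forall>i<length es. smooth_fun_on A (\<Union>\<U> \<inter> W) (c i)) \<and>
      (\<forall>p\<in>\<Union>\<U> \<inter> W. s p = (\<Sum>i<length es. c i p *\<^sub>R (es ! i) p))"
    by blast
qed

lemma Union_frames: "(\<Union>(fst ` frames E)) = UNIV"
  using frame_cover by (auto simp: image_iff) (metis fst_conv)

lemma bundle_map_sum:
  assumes "bundle_map A E E F" "\<And>i. i \<in> X \<Longrightarrow> v i \<in> fibre E p"
  shows "F p (\<Sum>i\<in>X. c i *\<^sub>R v i) = (\<Sum>i\<in>X. c i *\<^sub>R F p (v i))"
proof -
  have zero: "F p 0 = 0"
    using assms(1) subspace_0[OF subspace_fibre[of p]] unfolding bundle_map_def by (metis scale_zero_left)
  show ?thesis using assms(2)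
  proof (induction X rule: infinite_finite_induct)
    case (insert i X)
    then have "c i *\<^sub>R v i \<in> fibre E p" "(\<Sum>i\<in>X. c i *\<^sub>R v i) \<in> fibre E p" "v i \<in> fibre E p"
      by (auto intro!: subspace_scale subspace_sum subspace_fibre)
    then show ?case using insert assms(1) by (simp add: bundle_map_def)
  qed (simp_all add: zero)
qed

text \<open>Smoothness of a bundle map is assumed for the images of frame sections only. It passes to
  arbitrary sections by expanding them in each frame and gluing.\<close>

lemma bundle_map_section:
  assumes F: "bundle_map A E E F" and s: "s \<in> sections_on A E UNIV"
  shows "(\<lambda>p. F p (s p)) \<in> sections_on A E UNIV"
proof -
  have "(\<lambda>p. F p (s p)) \<in> sections_on A E W" if W: "(W,es) \<in> frames E" for W es
  proof -
    obtain c where c: "\<And>i. i < length es \<Longrightarrow> smooth_fun_on A W (c i)"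
        "\<And>p. p \<in> W \<Longrightarrow> s p = (\<Sum>i<length es. c i p *\<^sub>R (es ! i) p)"
      using section_coefficients[OF s W] by auto
    have "(\<lambda>p. \<Sum>i<length es. c i p *\<^sub>R F p ((es ! i) p)) \<in> sections_on A E W"
    proof (intro sections_on_sum sections_on_scale)
      show "(\<lambda>p. F p ((es ! i) p)) \<in> sections_on A E W" if "i \<in> {..<length es}" for i
        using F W that unfolding bundle_map_def by fastforce
    qed (use c in simp)
    moreover have "F p (s p) = (\<Sum>i<length es. c i p *\<^sub>R F p ((es ! i) p))" if "p \<in> W" for p
      unfolding c(2)[OF that]
      by (rule bundle_map_sum[OF F]) (use that frame(2)[OF W] in \<open>auto simp: sections_on_def\<close>)
    ultimately show ?thesis by (auto intro: sections_on_cong)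
  qed
  then have "(\<lambda>p. F p (s p)) \<in> sections_on A E (\<Union>(fst ` frames E))"
    using frame(1) by (intro sections_on_Union) auto
  then show ?thesis by (simp add: Union_frames)
qed

end

section \<open>Nondegenerate forms\<close>

text \<open>With a basis \<open>B\<close>, the map \<open>x \<mapsto> (\<Sum>b\<in>B. g x b *\<^sub>R b)\<close> is injective on the span of \<open>B\<close> by
  nondegeneracy. It is thus surjective by counting dimensions, and a preimage of
  \<open>\<Sum>b\<in>B. \<phi> b *\<^sub>R b\<close> represents \<open>\<phi>\<close>.\<close>

lemma riesz_representation:
  fixes B :: "'v::real_vector set"
  assumes "finite B" "independent B"
    and add: "\<And>x y z. x \<in> span B \<Longrightarrow> y \<in> span B \<Longrightarrow> z \<in> span B \<Longrightarrow> g (x + y) z = g x z + g y z"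
    and scale: "\<And>c x y. x \<in> span B \<Longrightarrow> y \<in> span B \<Longrightarrow> g (c *\<^sub>R x) y = c * g x y"
    and sym: "\<And>x y. x \<in> span B \<Longrightarrow> y \<in> span B \<Longrightarrow> g x y = g y x"
    and nondeg: "\<And>x. x \<in> span B \<Longrightarrow> (\<And>y. y \<in> span B \<Longrightarrow> g x y = 0) \<Longrightarrow> x = 0"
    and \<phi>_add: "\<And>x y. x \<in> span B \<Longrightarrow> y \<in> span B \<Longrightarrow> \<phi> (x + y) = \<phi> x + (\<phi> y :: real)"
    and \<phi>_scale: "\<And>c x. x \<in> span B \<Longrightarrow> \<phi> (c *\<^sub>R x) = c * \<phi> x"
  obtains e where "e \<in> span B" "\<And>x. x \<in> span B \<Longrightarrow> g e x = \<phi> x"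
proof -
  have determined: "\<alpha> x = \<beta> x"
    if add\<alpha>: "\<And>x y. x \<in> span B \<Longrightarrow> y \<in> span B \<Longrightarrow> \<alpha> (x + y) = \<alpha> x + (\<alpha> y :: real)"
      and scale\<alpha>: "\<And>c x. x \<in> span B \<Longrightarrow> \<alpha> (c *\<^sub>R x) = c * \<alpha> x"
      and add\<beta>: "\<And>x y. x \<in> span B \<Longrightarrow> y \<in> span B \<Longrightarrow> \<beta> (x + y) = \<beta> x + (\<beta> y :: real)"
      and scale\<beta>: "\<And>c x. x \<in> span B \<Longrightarrow> \<beta> (c *\<^sub>R x) = c * \<beta> x"
      and eq: "\<And>b. b \<in> B \<Longrightarrow> \<alpha> b = \<beta> b" and x: "x \<in> span B" for \<alpha> \<beta> x
  proof -
    have "subspace {x \<in> span B. \<alpha> x = \<beta> x}"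
      using scale\<alpha>[of 0 0] scale\<beta>[of 0 0] add\<alpha> add\<beta> scale\<alpha> scale\<beta>
      by (auto simp: subspace_def span_zero span_add span_scale)
    then have "span B \<subseteq> {x \<in> span B. \<alpha> x = \<beta> x}"
      using eq by (intro span_minimal) (auto simp: span_base)
    with x show ?thesis by auto
  qed
  \<comment> \<open>\<open>g\<close> is linear on the span only, so the map is first defined on \<open>B\<close> and extended\<close>
  obtain L where L: "linear L" "\<And>b. b \<in> B \<Longrightarrow> L b = (\<Sum>b'\<in>B. g b b' *\<^sub>R b')"
    using linear_independent_extend[OF assms(2), of "\<lambda>b. \<Sum>b'\<in>B. g b b' *\<^sub>R b'"] by blast
  have L_eq: "L x = (\<Sum>b'\<in>B. g x b' *\<^sub>R b')" if "x \<in> span B" for x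
  proof -
    have "g 0 b = 0" if "b \<in> B" for b
      using scale[of 0 b 0] that by (simp add: span_base span_zero)
    then have "subspace {x \<in> span B. L x = (\<Sum>b'\<in>B. g x b' *\<^sub>R b')}"
      using L(1) by (auto simp: subspace_def span_zero span_add span_scale linear_0 linear_add
          linear_scale add scale span_base scaleR_left_distrib sum.distrib scaleR_sum_right)
    then have "span B \<subseteq> {x \<in> span B. L x = (\<Sum>b'\<in>B. g x b' *\<^sub>R b')}"
      using L(2) by (intro span_minimal) (auto simp: span_base)
    with that show ?thesis by auto
  qed
  have coeff: "g x b = a b" if "x \<in> span B" "L x = (\<Sum>b\<in>B. a b *\<^sub>R b)" "b \<in> B" for x a b
  proof -
    have "(\<Sum>b\<in>B. (g x b - a b) *\<^sub>R b) = 0"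
      using that L_eq by (simp add: scaleR_left_diff_distrib sum_subtractf)
    from independentD[OF assms(2,1) _ this] that(3) show ?thesis by simp
  qed
  have inj: "inj_on L (span B)"
  proof -
    have "x = 0" if x: "x \<in> span B" "L x = 0" for x
    proof (rule nondeg[OF x(1)])
      fix y assume y: "y \<in> span B"
      have "g b x = 0" if "b \<in> B" for b
        using coeff[of x "\<lambda>b. 0" b] x that sym[of x b] by (simp add: span_base)
      then have "g y x = 0"
        using determined[of "\<lambda>y. g y x" "\<lambda>y. 0" y] add scale x(1) y by simp
      with sym[OF x(1) y] show "g x y = 0" by simp
    qed
    then show ?thesis
      using L(1) by (auto simp: linear_inj_on_iff_eq_0)
  qed
  have "independent (L ` B)"
    using linear_independent_injective_image[OF L(1) assms(2) inj] .
  moreover have "L ` B \<subseteq> span B"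
    using L_eq by (auto simp: span_base intro!: span_sum span_scale)
  moreover have "card (L ` B) = card B"
    using inj by (meson card_image inj_on_subset span_superset)
  ultimately have "b \<in> span (L ` B)" if "b \<in> B" for b
    using that assms(1) independent_span_bound[OF assms(1), of "insert b (L ` B)"]
      independent_insertI[of b "L ` B"]
    by (cases "b \<in> L ` B") (auto simp: span_base)
  then have "span B \<subseteq> L ` span B"
    using span_minimal[OF _ subspace_span, of B "L ` B"] linear_span_image[OF L(1), of B] by auto
  moreover have "(\<Sum>b\<in>B. \<phi> b *\<^sub>R b) \<in> span B"
    by (intro span_sum span_scale span_base)
  ultimately obtain e where e: "e \<in> span B" "L e = (\<Sum>b\<in>B. \<phi> b *\<^sub>R b)"
    by (metis (no_types, lifting) image_iff subsetD)
  have "g e x = \<phi> x" if x: "x \<in> span B" for x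
  proof -
    have "g b e = \<phi> b" if "b \<in> B" for b
      using coeff[OF e that] sym[OF e(1) span_base[OF that]] by simp
    then have "g x e = \<phi> x"
      using determined[of "\<lambda>x. g x e" \<phi> x] add scale e(1) \<phi>_add \<phi>_scale x by simp
    with sym[OF x e(1)] show ?thesis by simp
  qed
  with e(1) show ?thesis by (rule that)
qed

context vector_bundle
begin

lemma metric_sum:
  assumes g: "smooth_metric A E g" and "\<And>i. i \<in> X \<Longrightarrow> x i \<in> fibre E p" "y \<in> fibre E p"
  shows "g p (\<Sum>i\<in>X. a i *\<^sub>R x i) y = (\<Sum>i\<in>X. a i * g p (x i) y)"
proof -
  have add: "g p (u + v) w = g p u w + g p v w" if "u \<in> fibre E p" "v \<in> fibre E p" "w \<in> fibre E p" for u v w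
    using g that by (simp add: smooth_metric_def)
  have scale: "g p (c *\<^sub>R u) w = c * g p u w" if "u \<in> fibre E p" "w \<in> fibre E p" for c u w
    using g that by (simp add: smooth_metric_def)
  show ?thesis using assms(2)
  proof (induction X rule: infinite_finite_induct)
    case (insert i X)
    then have "a i *\<^sub>R x i \<in> fibre E p" "(\<Sum>i\<in>X. a i *\<^sub>R x i) \<in> fibre E p" "x i \<in> fibre E p"
      by (auto intro!: subspace_scale subspace_sum subspace_fibre)
    then show ?case using insert assms(3) by (simp add: add scale)
  qed (use scale[of 0 y 0] assms(3) subspace_0[OF subspace_fibre] in auto)
qed

lemma smooth_metric_sections:
  assumes g: "smooth_metric A E g" and s: "s \<in> sections_on A E UNIV" and t: "t \<in> sections_on A E UNIV"
  shows "smooth_fun_on A UNIV (\<lambda>p. g p (s p) (t p))"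
proof -
  have "smooth_fun_on A W (\<lambda>p. g p (s p) (t p))" if W: "(W,es) \<in> frames E" for W es
  proof -
    obtain c where c: "\<And>i. i < length es \<Longrightarrow> smooth_fun_on A W (c i)"
        "\<And>p. p \<in> W \<Longrightarrow> s p = (\<Sum>i<length es. c i p *\<^sub>R (es ! i) p)"
      using section_coefficients[OF s W] by auto
    obtain d where d: "\<And>i. i < length es \<Longrightarrow> smooth_fun_on A W (d i)"
        "\<And>p. p \<in> W \<Longrightarrow> t p = (\<Sum>i<length es. d i p *\<^sub>R (es ! i) p)"
      using section_coefficients[OF t W] by auto
    have ge: "smooth_fun_on A W (\<lambda>p. g p ((es ! j) p) ((es ! i) p))" if "i < length es" "j < length es" for i j
      using bspec[OF conjunct2[OF g[unfolded smooth_metric_def]] W] that by simp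
    have "smooth_fun_on A W (\<lambda>p. \<Sum>i<length es. c i p * (\<Sum>j<length es. d j p * g p ((es ! j) p) ((es ! i) p)))"
      by (intro smooth_fun_on_sum smooth_fun_on_mult) (simp_all add: c d ge)
    moreover have "(\<Sum>i<length es. c i p * (\<Sum>j<length es. d j p * g p ((es ! j) p) ((es ! i) p)))
        = g p (s p) (t p)" if p: "p \<in> W" for p
    proof -
      have e: "(es ! i) p \<in> fibre E p" if "i < length es" for i
        using frame(2)[OF W, of "es ! i"] p that by (simp add: sections_on_def)
      have tp: "t p \<in> fibre E p" using t by (simp add: sections_on_def)
      have sym: "g p x y = g p y x" if "x \<in> fibre E p" "y \<in> fibre E p" for x y
        using g that by (simp add: smooth_metric_def)
      have "g p (s p) (t p) = (\<Sum>i<length es. c i p * g p ((es ! i) p) (t p))"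
        unfolding c(2)[OF p] by (rule metric_sum[OF g _ tp]) (simp add: e)
      also have "\<dots> = (\<Sum>i<length es. c i p * g p (t p) ((es ! i) p))"
        by (rule sum.cong) (simp_all add: sym e tp)
      also have "\<dots> = (\<Sum>i<length es. c i p * (\<Sum>j<length es. d j p * g p ((es ! j) p) ((es ! i) p)))"
        unfolding d(2)[OF p] by (intro sum.cong refl arg_cong2[where f = "(*)"] metric_sum[OF g]) (simp_all add: e)
      finally show ?thesis by simp
    qed
    ultimately show ?thesis by (rule smooth_fun_on_cong[OF frame(1)[OF W]])
  qed
  then have "smooth_fun_on A (\<Union>(fst ` frames E)) (\<lambda>p. g p (s p) (t p))"
    using frame(1) by (intro smooth_fun_on_Union) auto
  then show ?thesis by (simp add: Union_frames)
qed

end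

section \<open>Courant algebroids\<close>

lemma scaleR_fun_apply [simp]: "(c *\<^sub>R f) x = c *\<^sub>R f x"
  by (simp add: scaleR_fun_def)

locale courant_bundle =
  fixes C :: "('m::{t2_space,second_countable_topology}, 'e::real_normed_vector, 'v::real_vector) courant"
  assumes courant: "courant_algebroid C"
begin

sublocale vector_bundle "base C" "vbdl C"
  using courant by unfold_locales (simp_all add: courant_algebroid_def)

lemma metric: "smooth_metric (base C) (vbdl C) (pairing C)"
  using courant by (simp add: courant_algebroid_def)

lemma section_fibre: "s \<in> sections C \<Longrightarrow> s p \<in> fibre (vbdl C) p"
  by (simp add: sections_def sections_on_def)

lemma subspace_sections: "subspace (sections C)"
  unfolding subspace_def sections_def zero_fun_def plus_fun_def scaleR_fun_def
  by (simp add: sections_on_zero sections_on_add sections_on_scale smooth_fun_on_const)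

lemma fscale_section: "f \<in> smooths C \<Longrightarrow> s \<in> sections C \<Longrightarrow> f \<odot> s \<in> sections C"
  by (simp add: smooths_def smooth_funs_def sections_def fscale_def sections_on_scale)

lemma app_section:
  "bundle_map (base C) (vbdl C) (vbdl C) F \<Longrightarrow> s \<in> sections C \<Longrightarrow> F \<cdot> s \<in> sections C"
  by (simp add: sections_def app_def bundle_map_section)

lemma pair_smooth: "s \<in> sections C \<Longrightarrow> t \<in> sections C \<Longrightarrow> pair C s t \<in> smooths C"
  unfolding pair_def smooths_def smooth_funs_def sections_def
  using smooth_metric_sections[OF metric] by simp

lemma pairing_linear:
  assumes "x \<in> fibre (vbdl C) p" "y \<in> fibre (vbdl C) p"
  shows "z \<in> fibre (vbdl C) p \<Longrightarrow> pairing C p (x + y) z = pairing C p x z + pairing C p y z"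
    "pairing C p (c *\<^sub>R x) y = c * pairing C p x y"
  using metric assms by (simp_all add: smooth_metric_def)

lemma pairing_commute:
  "x \<in> fibre (vbdl C) p \<Longrightarrow> y \<in> fibre (vbdl C) p \<Longrightarrow> pairing C p x y = pairing C p y x"
  using metric by (simp add: smooth_metric_def)

lemma pairing_nondegenerate:
  assumes "x \<in> fibre (vbdl C) p" "y \<in> fibre (vbdl C) p"
    and "\<And>z. z \<in> fibre (vbdl C) p \<Longrightarrow> pairing C p x z = pairing C p y z"
  shows "x = y"
proof -
  have "x + (-1) *\<^sub>R y \<in> fibre (vbdl C) p"
    by (intro subspace_add subspace_scale subspace_fibre assms)
  moreover have "pairing C p (x + (-1) *\<^sub>R y) z = 0" if z: "z \<in> fibre (vbdl C) p" for z
  proof -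
    have "pairing C p (x + (-1) *\<^sub>R y) z = pairing C p x z + pairing C p ((-1) *\<^sub>R y) z"
      by (intro pairing_linear(1) subspace_scale subspace_fibre assms z)
    also have "pairing C p ((-1) *\<^sub>R y) z = -1 * pairing C p y z"
      by (intro pairing_linear(2) assms z)
    finally show ?thesis using assms(3)[OF z] by simp
  qed
  ultimately have "x + (-1) *\<^sub>R y = 0"
    using metric unfolding smooth_metric_def by blast
  then show ?thesis by simp
qed

lemma anchor_bundle_map: "bundle_map (base C) (vbdl C) (tangent_bundle (base C)) (anchor C)"
  using courant by (simp add: courant_algebroid_def)

lemma anchor_linear:
  assumes "x \<in> fibre (vbdl C) p" "y \<in> fibre (vbdl C) p"
  shows "anchor C p (x + y) f = anchor C p x f + anchor C p y f"
    "anchor C p (c *\<^sub>R x) f = c * anchor C p x f"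
  using anchor_bundle_map assms by (simp_all add: bundle_map_def)

lemma anchor_mult:
  assumes "x \<in> fibre (vbdl C) p" "f \<in> smooths C" "h \<in> smooths C"
  shows "anchor C p x (f * h) = f p * anchor C p x h + h p * anchor C p x f"
  using anchor_bundle_map assms by (simp add: bundle_map_def tangent_bundle_def tangent_space_def smooths_def)

text \<open>At each point \<open>x \<mapsto> \<rho>(x)f / 2\<close> is a linear functional on the fibre, so it has a representative. By
  nondegeneracy there is only one, and the definite description in \<open>grad\<close> denotes it.\<close>

lemma grad:
  shows "grad C f p \<in> fibre (vbdl C) p"
    and "x \<in> fibre (vbdl C) p \<Longrightarrow> pairing C p (grad C f p) x = anchor C p x f / 2"
proof -
  obtain W es where W: "(W,es) \<in> frames (vbdl C)" "p \<in> W" by (rule frame_cover)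
  define B where "B = set (map (\<lambda>e. e p) es)"
  have B: "finite B" "independent B" "span B = fibre (vbdl C) p"
    using frame(4,5)[OF W] by (simp_all add: B_def)
  obtain e where e: "e \<in> fibre (vbdl C) p"
      "\<And>x. x \<in> fibre (vbdl C) p \<Longrightarrow> pairing C p e x = anchor C p x f / 2"
  proof (rule riesz_representation[OF B(1,2), of "pairing C p" "\<lambda>x. anchor C p x f / 2", unfolded B(3)])
    show "x = 0" if "x \<in> fibre (vbdl C) p" "\<And>y. y \<in> fibre (vbdl C) p \<Longrightarrow> pairing C p x y = 0" for x
      using metric that unfolding smooth_metric_def by blast
  qed (use pairing_linear pairing_commute in \<open>simp_all add: anchor_linear add_divide_distrib\<close>)
  then have "grad C f p = e"
    unfolding grad_def
  proof (intro the_equality conjI ballI)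
    fix e' assume e': "e' \<in> fibre (vbdl C) p \<and> (\<forall>x\<in>fibre (vbdl C) p. pairing C p e' x = anchor C p x f / 2)"
    show "e' = e"
      by (rule pairing_nondegenerate[of _ p]) (use e e' in \<open>simp_all del: eq_divide_eq_numeral1\<close>)
  qed
  with e show "grad C f p \<in> fibre (vbdl C) p"
    "x \<in> fibre (vbdl C) p \<Longrightarrow> pairing C p (grad C f p) x = anchor C p x f / 2"
    by auto
qed

lemma grad_mult:
  assumes "f \<in> smooths C" "h \<in> smooths C"
  shows "grad C (f * h) p = f p *\<^sub>R grad C h p + h p *\<^sub>R grad C f p"
proof (rule pairing_nondegenerate[of _ p])
  note sub = grad(1) subspace_scale[OF subspace_fibre] subspace_add[OF subspace_fibre]
  show "grad C (f * h) p \<in> fibre (vbdl C) p" "f p *\<^sub>R grad C h p + h p *\<^sub>R grad C f p \<in> fibre (vbdl C) p"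
    by (intro sub)+
  show "pairing C p (grad C (f * h) p) z = pairing C p (f p *\<^sub>R grad C h p + h p *\<^sub>R grad C f p) z"
    if "z \<in> fibre (vbdl C) p" for z
    using that assms by (simp add: pairing_linear sub grad(2) anchor_mult add_divide_distrib)
qed

lemma dorfman_bilinear: "real_bilinear_on (sections C) (dorfman C)"
  using courant by (simp add: courant_algebroid_def)

lemma dorfman_symmetric_part:
  "x \<in> sections C \<Longrightarrow> y \<in> sections C \<Longrightarrow> dorfman C x y + dorfman C y x = 2 *\<^sub>R grad C (pair C x y)"
  using courant by (simp add: courant_algebroid_def)

lemma dorfman_fscale_right:
  "f \<in> smooths C \<Longrightarrow> x \<in> sections C \<Longrightarrow> y \<in> sections C \<Longrightarrow>
    dorfman C x (f \<odot> y) = anchor_deriv C x f \<odot> y + f \<odot> dorfman C x y"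
  using courant by (simp add: courant_algebroid_def)

text \<open>The term \<open>2\<langle>x, y\<rangle>\<D>f\<close> comes from moving \<open>f\<close> out of \<open>2\<D>\<langle>f x, y\<rangle>\<close>. It is the reason why the
  hypercomplex connection fails the usual Leibniz rule by \<open>\<triangle>\<^sub>f\<close>.\<close>

lemma dorfman_fscale_left:
  assumes f: "f \<in> smooths C" and x: "x \<in> sections C" and y: "y \<in> sections C"
  shows "dorfman C (f \<odot> x) y
    = f \<odot> dorfman C x y - anchor_deriv C y f \<odot> x + (2 *\<^sub>R pair C x y) \<odot> grad C f"
proof
  fix p
  have "pair C (f \<odot> x) y = f * pair C x y"
    using x y by (auto simp: pair_def fscale_def pairing_linear section_fibre)
  then have "(dorfman C (f \<odot> x) y + dorfman C y (f \<odot> x)) p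
      = 2 *\<^sub>R (f p *\<^sub>R grad C (pair C x y) p + pair C x y p *\<^sub>R grad C f p)"
    using dorfman_symmetric_part[OF fscale_section[OF f x] y] f x y
    by (simp add: grad_mult pair_smooth)
  moreover have "2 *\<^sub>R grad C (pair C x y) p = dorfman C x y p + dorfman C y x p"
    using dorfman_symmetric_part[OF x y] by (metis plus_fun_apply scaleR_fun_apply)
  then have "2 *\<^sub>R (f p *\<^sub>R grad C (pair C x y) p) = f p *\<^sub>R (dorfman C x y p + dorfman C y x p)"
    by (metis scaleR_left_commute)
  ultimately show "dorfman C (f \<odot> x) y p
      = (f \<odot> dorfman C x y - anchor_deriv C y f \<odot> x + (2 *\<^sub>R pair C x y) \<odot> grad C f) p"
    using dorfman_fscale_right[OF f y x] by (simp add: fscale_def algebra_simps)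
qed

end

section \<open>Hypercomplex structures on Courant algebroids\<close>

locale hypercomplex_courant = courant_bundle C
  for C :: "('m::{t2_space,second_countable_topology}, 'e::real_normed_vector, 'v::real_vector) courant" +
  fixes I J K :: "'m \<Rightarrow> 'v \<Rightarrow> 'v"
  assumes hypercomplex: "hypercomplex C I J K"
begin

lemma almost_complex: "almost_complex C I" "almost_complex C J" "almost_complex C K"
  and IJK: "x \<in> fibre (vbdl C) p \<Longrightarrow> I p (J p (K p x)) = - x"
  using hypercomplex by (simp_all add: hypercomplex_def almost_hypercomplex_def)

lemma bundle_maps:
  "bundle_map (base C) (vbdl C) (vbdl C) I" "bundle_map (base C) (vbdl C) (vbdl C) J"
  "bundle_map (base C) (vbdl C) (vbdl C) K"
  using almost_complex by (simp_all add: almost_complex_def)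

text \<open>The quaternions act on each fibre and on the space of sections. Identities with functions as
  coefficients are checked on the fibres, those with brackets on sections.\<close>

sublocale fib: quaternionic "fibre (vbdl C) p" "I p" "J p" "K p" for p
proof
  show "subspace (fibre (vbdl C) p)" by (rule subspace_fibre)
qed (use almost_complex IJK in \<open>simp_all add: almost_complex_def bundle_map_def\<close>)

lemma pair_orthogonal:
  assumes "x \<in> sections C" "y \<in> sections C"
  shows "pair C (I \<cdot> x) (I \<cdot> y) = pair C x y" "pair C (J \<cdot> x) (J \<cdot> y) = pair C x y"
  using assms almost_complex by (simp_all add: pair_def app_def almost_complex_def section_fibre)

sublocale sec: hypercomplex_bracket "sections C" "(\<cdot>) I" "(\<cdot>) J" "(\<cdot>) K" "dorfman C"
proof
  show "subspace (sections C)" by (rule subspace_sections)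
  show "real_bilinear_on (sections C) (dorfman C)" by (rule dorfman_bilinear)
  note pointwise = fun_eq_iff app_def section_fibre fib.normalise
  fix x y and c :: real assume x: "x \<in> sections C"
  show I: "I \<cdot> x \<in> sections C" and "J \<cdot> x \<in> sections C" and "K \<cdot> x \<in> sections C"
    using x bundle_maps by (simp_all add: app_section)
  show "I \<cdot> (c *\<^sub>R x) = c *\<^sub>R I \<cdot> x" "J \<cdot> (c *\<^sub>R x) = c *\<^sub>R J \<cdot> x" "K \<cdot> (c *\<^sub>R x) = c *\<^sub>R K \<cdot> x"
    "I \<cdot> I \<cdot> x = - x" "J \<cdot> J \<cdot> x = - x" "K \<cdot> K \<cdot> x = - x" "I \<cdot> J \<cdot> K \<cdot> x = - x"
    using x by (simp_all add: pointwise)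
  assume y: "y \<in> sections C"
  show "I \<cdot> (x + y) = I \<cdot> x + I \<cdot> y" "J \<cdot> (x + y) = J \<cdot> x + J \<cdot> y" "K \<cdot> (x + y) = K \<cdot> x + K \<cdot> y"
    using x y by (simp_all add: pointwise)
  have Iy: "I \<cdot> y \<in> sections C"
    using y bundle_maps by (simp add: app_section)
  show "dorfman C (I \<cdot> x) (I \<cdot> y) + dorfman C (I \<cdot> y) (I \<cdot> x) = dorfman C x y + dorfman C y x"
    using x y I Iy by (simp add: dorfman_symmetric_part pair_orthogonal)
  show "nijenhuis_concomitant (dorfman C) ((\<cdot>) I) ((\<cdot>) I) x y = 0" "nijenhuis_concomitant (dorfman C) ((\<cdot>) J) ((\<cdot>) J) x y = 0"
    "nijenhuis_concomitant (dorfman C) ((\<cdot>) K) ((\<cdot>) K) x y = 0" "nijenhuis_concomitant (dorfman C) ((\<cdot>) I) ((\<cdot>) J) x y = 0"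
    "nijenhuis_concomitant (dorfman C) ((\<cdot>) I) ((\<cdot>) K) x y = 0"
    using hypercomplex x y by (simp_all add: hypercomplex_def nijenhuis_def nijenhuis_concomitant_def)
qed

lemma sym_eq_grad: "x \<in> sections C \<Longrightarrow> y \<in> sections C \<Longrightarrow> sec.sym x y = grad C (pair C x y)"
  by (simp add: sec.sym_def dorfman_symmetric_part)

lemma app_fscale:
  assumes "s \<in> sections C"
  shows "I \<cdot> (f \<odot> s) = f \<odot> I \<cdot> s" "J \<cdot> (f \<odot> s) = f \<odot> J \<cdot> s" "K \<cdot> (f \<odot> s) = f \<odot> K \<cdot> s"
  using assms by (simp_all add: app_def fscale_def section_fibre fib.homogeneous)

lemma pair_minus: "u \<in> sections C \<Longrightarrow> v \<in> sections C \<Longrightarrow> pair C (- u) v = - pair C u v"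
  using pairing_linear(2)[of "u p" p "v p" "-1" for p]
  by (simp add: fun_eq_iff pair_def section_fibre)

lemma pair_commute: "u \<in> sections C \<Longrightarrow> v \<in> sections C \<Longrightarrow> pair C u v = pair C v u"
  by (simp add: fun_eq_iff pair_def section_fibre pairing_commute)

lemma pair_J_skew:
  assumes "x \<in> sections C" "y \<in> sections C"
  shows "pair C (J \<cdot> x) y = - pair C x (J \<cdot> y)"
  using pair_orthogonal(2)[of "J \<cdot> x" y] assms by (simp add: sec.normalise pair_minus)

text \<open>Here \<open>f\<close> occurs in second arguments of brackets only. The derivative of \<open>f\<close> along \<open>J V\<close> enters with
  the factor \<open>I U - I U\<close>, the one along \<open>V\<close> with \<open>- J I U + J I U\<close>.\<close>

lemma connection_fscale_left:
  assumes f: "f \<in> smooths C" and U: "U \<in> sections C" and V: "V \<in> sections C"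
  shows "sec.connection (f \<odot> U) V = f \<odot> sec.connection U V"
proof -
  define a b c d where "a = dorfman C (J \<cdot> V) (I \<cdot> U)" and "b = dorfman C V (I \<cdot> U)"
    and "c = dorfman C (J \<cdot> V) U" and "d = dorfman C V U"
  have fib: "a p \<in> fibre (vbdl C) p" "b p \<in> fibre (vbdl C) p" "c p \<in> fibre (vbdl C) p"
      "d p \<in> fibre (vbdl C) p" "U p \<in> fibre (vbdl C) p" for p
    using U V by (auto simp: a_def b_def c_def d_def intro!: section_fibre sec.B_mem sec.closed)
  define \<alpha> \<beta> where "\<alpha> = anchor_deriv C (J \<cdot> V) f" and "\<beta> = anchor_deriv C V f"
  have "sec.connection (f \<odot> U) V = - ((1/2) *\<^sub>R K \<cdot> (\<alpha> \<odot> (I \<cdot> U) + f \<odot> a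
      - J \<cdot> (\<beta> \<odot> (I \<cdot> U) + f \<odot> b) - I \<cdot> (\<alpha> \<odot> U + f \<odot> c) + J \<cdot> I \<cdot> (\<beta> \<odot> U + f \<odot> d)))"
    using f U V by (simp add: sec.connection_def app_fscale dorfman_fscale_right sec.closed
        a_def b_def c_def d_def \<alpha>_def \<beta>_def)
  also have "\<dots> = f \<odot> - ((1/2) *\<^sub>R K \<cdot> (a - J \<cdot> b - I \<cdot> c + J \<cdot> I \<cdot> d))"
    by (simp add: fun_eq_iff app_def fscale_def fib fib.normalise algebra_simps)
  finally show ?thesis by (simp add: sec.connection_def a_def b_def c_def d_def)
qed

text \<open>Here \<open>f\<close> occurs in first arguments. The derivative of \<open>f\<close> along \<open>I U\<close> cancels as before, while the one
  along \<open>U\<close> has the factor \<open>I J V - J I V = 2 K V\<close>.\<close>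

lemma connection_fscale_right:
  assumes f: "f \<in> smooths C" and U: "U \<in> sections C" and V: "V \<in> sections C"
  shows "sec.connection U (f \<odot> V)
    = anchor_deriv C U f \<odot> V + f \<odot> sec.connection U V - triangle C I J K f U V"
proof -
  define a b c d where "a = dorfman C (J \<cdot> V) (I \<cdot> U)" and "b = dorfman C V (I \<cdot> U)"
    and "c = dorfman C (J \<cdot> V) U" and "d = dorfman C V U"
  have fib: "a p \<in> fibre (vbdl C) p" "b p \<in> fibre (vbdl C) p" "c p \<in> fibre (vbdl C) p"
      "d p \<in> fibre (vbdl C) p" "V p \<in> fibre (vbdl C) p" for p
    using U V by (auto simp: a_def b_def c_def d_def intro!: section_fibre sec.B_mem sec.closed)
  define \<alpha> \<beta> D where "\<alpha> = anchor_deriv C (I \<cdot> U) f" and "\<beta> = anchor_deriv C U f"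
    and "D = grad C f"
  have fibD: "D p \<in> fibre (vbdl C) p" for p
    by (simp add: D_def grad(1))
  define q\<^sub>0 q\<^sub>1 q\<^sub>2 q\<^sub>3 where "q\<^sub>0 = pair C U V" and "q\<^sub>1 = pair C (I \<cdot> U) V"
    and "q\<^sub>2 = pair C (J \<cdot> U) V" and "q\<^sub>3 = pair C (K \<cdot> U) V"
  have q: "pair C V U = q\<^sub>0" "pair C V (I \<cdot> U) = q\<^sub>1" "pair C (J \<cdot> V) U = - q\<^sub>2"
      "pair C (J \<cdot> V) (I \<cdot> U) = q\<^sub>3"
    using U V pair_J_skew[of U V] pair_J_skew[of "I \<cdot> U" V]
    by (simp_all add: q\<^sub>0_def q\<^sub>1_def q\<^sub>2_def q\<^sub>3_def pair_commute[of V] pair_commute[of "J \<cdot> V"]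
        pair_minus sec.normalise)
  have "sec.connection U (f \<odot> V) = - ((1/2) *\<^sub>R K \<cdot> (
      (f \<odot> a - \<alpha> \<odot> (J \<cdot> V) + (2 *\<^sub>R q\<^sub>3) \<odot> D)
      - J \<cdot> (f \<odot> b - \<alpha> \<odot> V + (2 *\<^sub>R q\<^sub>1) \<odot> D)
      - I \<cdot> (f \<odot> c - \<beta> \<odot> (J \<cdot> V) + (2 *\<^sub>R (- q\<^sub>2)) \<odot> D)
      + J \<cdot> I \<cdot> (f \<odot> d - \<beta> \<odot> V + (2 *\<^sub>R q\<^sub>0) \<odot> D)))"
    using f U V by (simp add: sec.connection_def app_fscale dorfman_fscale_left sec.closed q
        a_def b_def c_def d_def \<alpha>_def \<beta>_def D_def)
  also have "\<dots> = \<beta> \<odot> V + f \<odot> - ((1/2) *\<^sub>R K \<cdot> (a - J \<cdot> b - I \<cdot> c + J \<cdot> I \<cdot> d))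
      - (q\<^sub>0 \<odot> D + q\<^sub>1 \<odot> I \<cdot> D + q\<^sub>2 \<odot> J \<cdot> D + q\<^sub>3 \<odot> K \<cdot> D)"
    by (simp add: fun_eq_iff app_def fscale_def fib fibD fib.normalise algebra_simps
        flip: scaleR_left_distrib)
  finally show ?thesis
    by (simp add: sec.connection_def triangle_def a_def b_def c_def d_def \<beta>_def D_def
        q\<^sub>0_def q\<^sub>1_def q\<^sub>2_def q\<^sub>3_def)
qed

text \<open>The formula defines an extensional function by restriction to sections, so agreement on
  sections is equality.\<close>

lemma connection_characterisation:
  defines "P \<equiv> \<lambda>nabla. hypercomplex_connection C I J K nabla \<and>
    parallel C nabla I \<and> parallel C nabla J \<and> parallel C nabla K \<and>
    (\<forall>U\<in>sections C. \<forall>V\<in>sections C. torsion C nabla U V =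
      I \<cdot> grad C (pair C U (I \<cdot> V)) + J \<cdot> grad C (pair C U (J \<cdot> V)) + K \<cdot> grad C (pair C U (K \<cdot> V)))"
  shows "P (\<lambda>U\<in>sections C. \<lambda>V\<in>sections C. sec.connection U V)" (is "P ?conn")
    and "P nabla \<Longrightarrow> nabla = (\<lambda>U\<in>sections C. \<lambda>V\<in>sections C. sec.connection U V)"
proof -
  have conn: "?conn U V = sec.connection U V" if "U \<in> sections C" "V \<in> sections C" for U V
    using that by simp
  have "real_bilinear_on (sections C) ?conn"
    using sec.connection_bilinear by (simp add: real_bilinear_on_def sec.mem)
  then show "P ?conn"
    unfolding P_def hypercomplex_connection_def parallel_def torsion_def
    by (simp add: fscale_section connection_fscale_left connection_fscale_right sec.closed
        sec.connection_mem sec.connection_I sec.connection_J sec.connection_K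
        sec.connection_torsion sym_eq_grad)
next
  assume P: "P nabla"
  show "nabla = (\<lambda>U\<in>sections C. \<lambda>V\<in>sections C. sec.connection U V)"
  proof (rule PiE_ext[where k = "sections C" and s = "\<lambda>_. sections C \<rightarrow>\<^sub>E sections C"])
    show nabla: "nabla \<in> sections C \<rightarrow>\<^sub>E sections C \<rightarrow>\<^sub>E sections C"
      using P by (simp add: P_def hypercomplex_connection_def)
    show "(\<lambda>U\<in>sections C. \<lambda>V\<in>sections C. sec.connection U V) \<in> sections C \<rightarrow>\<^sub>E sections C \<rightarrow>\<^sub>E sections C"
      by (simp add: sec.connection_mem)
    fix U assume U: "U \<in> sections C"
    have "nabla U V = sec.connection U V" if V: "V \<in> sections C" for V
      using P nabla U V unfolding P_def parallel_def torsion_def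
      by (intro sec.connection_unique) (auto simp: sym_eq_grad sec.closed)
    with U nabla show "nabla U = (\<lambda>U\<in>sections C. \<lambda>V\<in>sections C. sec.connection U V) U"
      by (intro PiE_ext[where k = "sections C" and s = "\<lambda>_. sections C"])
        (auto simp: sec.connection_mem)
  qed
qed

end

theorem theorem3p13:
  fixes C :: "('m::{t2_space,second_countable_topology}, 'e::real_normed_vector, 'v::real_vector) courant"
    and I J K :: "'m \<Rightarrow> 'v \<Rightarrow> 'v"
  assumes "courant_algebroid C"
    and "hypercomplex C I J K"
  shows "(\<exists>!nabla. hypercomplex_connection C I J K nabla \<and>
            parallel C nabla I \<and> parallel C nabla J \<and> parallel C nabla K \<and>
            (\<forall>U\<in>sections C. \<forall>V\<in>sections C. torsion C nabla U V =
               I \<cdot> grad C (pair C U (I \<cdot> V)) + J \<cdot> grad C (pair C U (J \<cdot> V)) + K \<cdot> grad C (pair C U (K \<cdot> V)))) \<and>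
         (\<forall>nabla. hypercomplex_connection C I J K nabla \<and>
            parallel C nabla I \<and> parallel C nabla J \<and> parallel C nabla K \<and>
            (\<forall>U\<in>sections C. \<forall>V\<in>sections C. torsion C nabla U V =
               I \<cdot> grad C (pair C U (I \<cdot> V)) + J \<cdot> grad C (pair C U (J \<cdot> V)) + K \<cdot> grad C (pair C U (K \<cdot> V))) \<longrightarrow>
            (\<forall>U\<in>sections C. \<forall>V\<in>sections C.
               nabla U V = - ((1/2) *\<^sub>R (K \<cdot> (dorfman C (J \<cdot> V) (I \<cdot> U) - J \<cdot> dorfman C V (I \<cdot> U)
                                        - I \<cdot> dorfman C (J \<cdot> V) U + J \<cdot> I \<cdot> dorfman C V U)))))"
proof -
  interpret hypercomplex_courant C I J K
    using assms by unfold_locales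
  note char = connection_characterisation
  show ?thesis
  proof (intro conjI allI impI ballI)
    show "\<exists>!nabla. hypercomplex_connection C I J K nabla \<and>
            parallel C nabla I \<and> parallel C nabla J \<and> parallel C nabla K \<and>
            (\<forall>U\<in>sections C. \<forall>V\<in>sections C. torsion C nabla U V =
               I \<cdot> grad C (pair C U (I \<cdot> V)) + J \<cdot> grad C (pair C U (J \<cdot> V)) + K \<cdot> grad C (pair C U (K \<cdot> V)))"
      by (rule ex1I, rule char(1), rule char(2))
  next
    fix nabla U V
    assume nabla: "hypercomplex_connection C I J K nabla \<and>
            parallel C nabla I \<and> parallel C nabla J \<and> parallel C nabla K \<and>
            (\<forall>U\<in>sections C. \<forall>V\<in>sections C. torsion C nabla U V =
               I \<cdot> grad C (pair C U (I \<cdot> V)) + J \<cdot> grad C (pair C U (J \<cdot> V)) + K \<cdot> grad C (pair C U (K \<cdot> V)))"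
      and "U \<in> sections C" "V \<in> sections C"
    then show "nabla U V = - ((1/2) *\<^sub>R (K \<cdot> (dorfman C (J \<cdot> V) (I \<cdot> U) - J \<cdot> dorfman C V (I \<cdot> U)
                                        - I \<cdot> dorfman C (J \<cdot> V) U + J \<cdot> I \<cdot> dorfman C V U)))"
      by (simp add: char(2)[OF nabla] sec.connection_def)
  qed
qed

end
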